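(* Consider the chemical reactor $$\frac{d}{dt}X^{in}=0,\qquad \frac{d}{dt}X=D(t)(X^{in}-X)-k\exp\left(-\frac{E_A}{RT}\right)X,$$ $$\frac{d}{dt}T=D(t)(T^{in}(t)-T)+c\exp\left(-\frac{E_A}{RT}\right)X+v(t),\qquad y=T,$$ with $X^{in}>0$, $X>0$. Assume there exist $M$ and $\alpha>0$ such that for all $t\ge0$: $M\ge X^{in}\ge\alpha$, $M\ge D(t)\ge\alpha$ and $M\ge T(t)\ge\alpha$. Then for any $\beta,\kappa>0$ the following non-linear observer is globally converging: $$\frac{d}{dt}\hat X^{in}=-\beta\exp\left(-\frac{E_A}{RT(t)}\right)(\hat T-T(t))\,c\hat X\,\hat X^{in},$$ $$\frac{d}{dt}\hat X=D(t)(\hat X^{in}-\hat X)-\exp\left(-\frac{E_A}{RT(t)}\right)\bigl(k+\beta(\hat T-T(t))\,c\hat X\bigr)\hat X,$$ $$\frac{d}{dt}\hat T=\exp\left(-\frac{E_A}{RT(t)}\right)\bigl(1-\kappa(\hat T-T(t))\bigr)c\hat X+D(t)(T^{in}(t)-T(t))+v(t).$$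
   Context: $E_A,R,k,c$ are positive known constants; $D(t)\ge0$, $T^{in}(t)$ and $v(t)$ are known functions of time; $T$ is the measured output; the inlet composition $X^{in}>0$ is an unknown constant and the composition $X$ is not measured. The physical domain for the system is $\{(X^{in},X,T)\in\mathbb{R}^3: X^{in}>0,\ X>0\}$, and for the observer it is $\{(\hat X^{in},\hat X,\hat T)\in\mathbb{R}^3:\hat X^{in}>0,\ \hat X>0\}$. "Globally converging" means that for every initial condition of the observer in this domain (and every system trajectory satisfying the hypotheses), $\hat X^{in}(t)-X^{in}\to0$, $\hat X(t)-X(t)\to0$ and $\hat T(t)-T(t)\to0$ as $t\to+\infty$. *)

theory Defs
  imports "HOL-Analysis.Analysis"
begin

definition arrhenius :: "real \<Rightarrow> real \<Rightarrow> real \<Rightarrow> real" where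
  "arrhenius E\<^sub>A R \<theta> = exp (- E\<^sub>A / (R * \<theta>))"

text \<open>Trajectories are given on the time interval \<open>[0, \<infinity>)\<close>, with a one-sided derivative at \<open>0\<close>.
  A reactor trajectory lies in the physical domain by definition.\<close>

definition reactor_trajectory ::
  "real \<Rightarrow> real \<Rightarrow> real \<Rightarrow> real \<Rightarrow> (real \<Rightarrow> real) \<Rightarrow> (real \<Rightarrow> real) \<Rightarrow> (real \<Rightarrow> real) \<Rightarrow>
   (real \<Rightarrow> real) \<Rightarrow> (real \<Rightarrow> real) \<Rightarrow> (real \<Rightarrow> real) \<Rightarrow> bool" where
  "reactor_trajectory E\<^sub>A R k c D T\<^sub>i\<^sub>n v X\<^sub>i\<^sub>n X T \<longleftrightarrow>
     (\<forall>t\<ge>0. X\<^sub>i\<^sub>n t > 0 \<and> X t > 0 \<and>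
        (X\<^sub>i\<^sub>n has_real_derivative 0) (at t within {0..}) \<and>
        (X has_real_derivative
           D t * (X\<^sub>i\<^sub>n t - X t) - k * arrhenius E\<^sub>A R (T t) * X t) (at t within {0..}) \<and>
        (T has_real_derivative
           D t * (T\<^sub>i\<^sub>n t - T t) + c * arrhenius E\<^sub>A R (T t) * X t + v t) (at t within {0..}))"

text \<open>Here \<open>T\<close> is the measured output that drives the observer, and \<open>Y\<^sub>i\<^sub>n\<close>, \<open>Y\<close>, \<open>S\<close> are the
  estimates of \<open>X\<^sub>i\<^sub>n\<close>, \<open>X\<close>, \<open>T\<close>. Positivity of \<open>Y\<^sub>i\<^sub>n\<close> and \<open>Y\<close> is not part of this definition;
  it is required in the definition of global convergence below.\<close>

definition observer_trajectory ::
  "real \<Rightarrow> real \<Rightarrow> real \<Rightarrow> real \<Rightarrow> real \<Rightarrow> real \<Rightarrow>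
   (real \<Rightarrow> real) \<Rightarrow> (real \<Rightarrow> real) \<Rightarrow> (real \<Rightarrow> real) \<Rightarrow> (real \<Rightarrow> real) \<Rightarrow>
   (real \<Rightarrow> real) \<Rightarrow> (real \<Rightarrow> real) \<Rightarrow> (real \<Rightarrow> real) \<Rightarrow> bool" where
  "observer_trajectory E\<^sub>A R k c \<beta> \<kappa> D T\<^sub>i\<^sub>n v T Y\<^sub>i\<^sub>n Y S \<longleftrightarrow>
     (\<forall>t\<ge>0.
        (Y\<^sub>i\<^sub>n has_real_derivative
           - \<beta> * arrhenius E\<^sub>A R (T t) * (S t - T t) * c * Y t * Y\<^sub>i\<^sub>n t) (at t within {0..}) \<and>
        (Y has_real_derivative
           D t * (Y\<^sub>i\<^sub>n t - Y t)
             - arrhenius E\<^sub>A R (T t) * (k + \<beta> * (S t - T t) * c * Y t) * Y t) (at t within {0..}) \<and>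
        (S has_real_derivative
           arrhenius E\<^sub>A R (T t) * (1 - \<kappa> * (S t - T t)) * c * Y t
             + D t * (T\<^sub>i\<^sub>n t - T t) + v t) (at t within {0..}))"

text \<open>From every initial condition in the observer's domain there is a trajectory defined for all
  \<open>t \<ge> 0\<close>, and every such trajectory stays in the domain and has vanishing estimation errors.
  Existence is part of the notion, since otherwise finite-time blow-up would count as convergence.\<close>

definition globally_converging_observer ::
  "real \<Rightarrow> real \<Rightarrow> real \<Rightarrow> real \<Rightarrow> real \<Rightarrow> real \<Rightarrow>
   (real \<Rightarrow> real) \<Rightarrow> (real \<Rightarrow> real) \<Rightarrow> (real \<Rightarrow> real) \<Rightarrow>
   (real \<Rightarrow> real) \<Rightarrow> (real \<Rightarrow> real) \<Rightarrow> (real \<Rightarrow> real) \<Rightarrow> bool" where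
  "globally_converging_observer E\<^sub>A R k c \<beta> \<kappa> D T\<^sub>i\<^sub>n v X\<^sub>i\<^sub>n X T \<longleftrightarrow>
     (\<forall>a b s. a > 0 \<longrightarrow> b > 0 \<longrightarrow>
        (\<exists>Y\<^sub>i\<^sub>n Y S. observer_trajectory E\<^sub>A R k c \<beta> \<kappa> D T\<^sub>i\<^sub>n v T Y\<^sub>i\<^sub>n Y S \<and>
           Y\<^sub>i\<^sub>n 0 = a \<and> Y 0 = b \<and> S 0 = s) \<and>
        (\<forall>Y\<^sub>i\<^sub>n Y S. observer_trajectory E\<^sub>A R k c \<beta> \<kappa> D T\<^sub>i\<^sub>n v T Y\<^sub>i\<^sub>n Y S \<longrightarrow>
           Y\<^sub>i\<^sub>n 0 = a \<longrightarrow> Y 0 = b \<longrightarrow> S 0 = s \<longrightarrow>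
           (\<forall>t\<ge>0. Y\<^sub>i\<^sub>n t > 0 \<and> Y t > 0) \<and>
           ((\<lambda>t. Y\<^sub>i\<^sub>n t - X\<^sub>i\<^sub>n t) \<longlongrightarrow> 0) at_top \<and>
           ((\<lambda>t. Y t - X t) \<longlongrightarrow> 0) at_top \<and>
           ((\<lambda>t. S t - T t) \<longlongrightarrow> 0) at_top))"

end

theory Submission imports Defs begin

text \<open>Write \<open>e\<close> for the Arrhenius factor along \<open>T\<close> and \<open>\<sigma> = S - T\<close> for the output error. The ratios
  \<open>w = X / X\<^sub>i\<^sub>n\<close> and \<open>u = Y / Y\<^sub>i\<^sub>n\<close> solve the same linear equation \<open>z' = D - (D + k e) z\<close>, so
  \<open>u - w\<close> decays exponentially. The remaining errors have the Lyapunov function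
  \<open>V = \<sigma>\<^sup>2 / 2 + (x - 1 - ln x) / \<beta>\<close> with \<open>x = X\<^sub>i\<^sub>n / Y\<^sub>i\<^sub>n\<close>, whose derivative is
  \<open>- \<kappa> e c Y \<sigma>\<^sup>2 + e c X\<^sub>i\<^sub>n \<sigma> (u - w)\<close>. As the second term is integrable up to a factor \<open>1 + V\<close>, the
  state stays in a compact subset of the domain, which yields global existence and \<open>\<sigma> \<longlongrightarrow> 0\<close>.
  Finally \<open>\<sigma>'\<close> is a positive multiple of \<open>Y\<^sub>i\<^sub>n - X\<^sub>i\<^sub>n\<close> up to vanishing terms, while \<open>Y\<^sub>i\<^sub>n\<close> varies ever
  more slowly, so that \<open>Y\<^sub>i\<^sub>n - X\<^sub>i\<^sub>n\<close> must vanish as well.\<close>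

subsection \<open>Calculus on the half-line\<close>

lemma abs_mult_nonneg_left: "0 \<le> a \<Longrightarrow> \<bar>a * b\<bar> = a * \<bar>b\<bar>" for a b :: real
  by (simp add: abs_mult)

lemma at_within_halfline: "at t within {0..} = at t" if "0 < t" for t :: real
  using that by (intro at_within_interior) auto

lemma monotone_of_deriv_nonneg:
  fixes f f' :: "real \<Rightarrow> real"
  assumes "a \<le> b" and "continuous_on {a..b} f"
    and "\<And>t. a < t \<Longrightarrow> t < b \<Longrightarrow> (f has_real_derivative f' t) (at t)"
    and "\<And>t. a < t \<Longrightarrow> t < b \<Longrightarrow> 0 \<le> f' t"
  shows "f a \<le> f b"
proof (rule DERIV_nonneg_imp_increasing_open[OF assms(1) _ assms(2)])
  show "\<exists>y. (f has_real_derivative y) (at t) \<and> y \<ge> 0" if "a < t" "t < b" for t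
    using assms(3,4) that by blast
qed

lemma antiderivative_halfline:
  fixes f :: "real \<Rightarrow> 'a :: banach"
  assumes "continuous_on {0..} f" and "0 \<le> t"
  shows "((\<lambda>u. integral {0..u} f) has_vector_derivative f t) (at t within {0..})"
proof -
  have "((\<lambda>u. integral {0..u} f) has_vector_derivative f t) (at t within {0..t+1})"
    using assms by (intro integral_has_vector_derivative continuous_on_subset[OF assms(1)]) auto
  moreover have "at t within {0..t+1} = at t within {0..}"
    by (rule at_within_nhd[where S = "{..<t+1}"]) auto
  ultimately show ?thesis by simp
qed

lemma has_derivative_imp_continuous_halfline:
  assumes "\<And>t. 0 \<le> t \<Longrightarrow> (f has_real_derivative f' t) (at t within {0..})"
  shows "continuous_on {0..} f"
  by (rule DERIV_continuous_on) (use assms in auto)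

text \<open>Integrating factor: with \<open>P\<close> an antiderivative of \<open>h\<close>, the
  product \<open>z * exp (- P)\<close> has nonnegative derivative.\<close>

lemma linear_comparison:
  fixes z z' h :: "real \<Rightarrow> real"
  assumes h: "continuous_on {0..} h"
    and z: "\<And>t. 0 \<le> t \<Longrightarrow> (z has_real_derivative z' t) (at t within {0..})"
    and le: "\<And>t. 0 \<le> t \<Longrightarrow> h t * z t \<le> z' t"
    and "0 \<le> t"
  shows "z 0 * exp (integral {0..t} h) \<le> z t"
proof -
  define P where "P = (\<lambda>t. integral {0..t} h)"
  have P: "(P has_real_derivative h t) (at t within {0..})" if "0 \<le> t" for t
    using antiderivative_halfline[OF h that]
    by (simp add: P_def has_real_derivative_iff_has_vector_derivative)
  have zP: "((\<lambda>t. z t * exp (- P t)) has_real_derivative (z' t - h t * z t) * exp (- P t))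
      (at t within {0..})" if "0 \<le> t" for t
    using that by (auto intro!: derivative_eq_intros z P simp: algebra_simps)
  have "z 0 * exp (- P 0) \<le> z t * exp (- P t)"
  proof (rule monotone_of_deriv_nonneg[where f = "\<lambda>t. z t * exp (- P t)"])
    show "continuous_on {0..t} (\<lambda>t. z t * exp (- P t))"
      by (rule continuous_on_subset[OF has_derivative_imp_continuous_halfline[OF zP]]) auto
    show "((\<lambda>t. z t * exp (- P t)) has_real_derivative (z' s - h s * z s) * exp (- P s)) (at s)"
      if "0 < s" for s
      using zP[of s] that by (simp add: at_within_halfline)
  qed (use le \<open>0 \<le> t\<close> in auto)
  then show ?thesis
    by (simp add: P_def exp_minus field_simps)
qed

text \<open>The energy \<open>(z t)\<^sup>2 * exp (2 * \<alpha> * t)\<close> cannot increase when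
  \<open>g \<ge> \<alpha>\<close>; taking square roots gives the bound. Its negative
  \<open>f\<close> fits the monotonicity lemma.\<close>

lemma linear_decay:
  fixes z g :: "real \<Rightarrow> real"
  assumes z: "\<And>t. 0 \<le> t \<Longrightarrow> (z has_real_derivative - g t * z t) (at t within {0..})"
    and g: "\<And>t. 0 \<le> t \<Longrightarrow> \<alpha> \<le> g t"
    and "0 \<le> t"
  shows "\<bar>z t\<bar> \<le> \<bar>z 0\<bar> * exp (- \<alpha> * t)"
proof -
  define f where "f = (\<lambda>t. - ((z t)\<^sup>2 * exp (2 * \<alpha> * t)))"
  have f: "(f has_real_derivative 2 * (g t - \<alpha>) * (z t)\<^sup>2 * exp (2 * \<alpha> * t)) (at t within {0..})"
    if "0 \<le> t" for t
    unfolding f_def using that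
    by (auto intro!: derivative_eq_intros z simp: algebra_simps power2_eq_square)
  have "f 0 \<le> f t"
  proof (rule monotone_of_deriv_nonneg[OF \<open>0 \<le> t\<close>])
    show "continuous_on {0..t} f"
      by (rule continuous_on_subset[OF has_derivative_imp_continuous_halfline[OF f]]) auto
    show "(f has_real_derivative 2 * (g s - \<alpha>) * (z s)\<^sup>2 * exp (2 * \<alpha> * s)) (at s)" if "0 < s" for s
      using f[of s] that by (simp add: at_within_halfline)
  qed (use g in auto)
  then have "(z t * exp (\<alpha> * t))\<^sup>2 \<le> (z 0)\<^sup>2"
    by (simp add: f_def power_mult_distrib exp_double[symmetric] mult.assoc)
  then have "\<bar>z t\<bar> * exp (\<alpha> * t) \<le> \<bar>z 0\<bar>"
    by (simp add: abs_le_square_iff[symmetric] abs_mult)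
  then show ?thesis
    by (simp add: exp_minus field_simps)
qed

text \<open>First exit time argument: the times outside \<open>U\<close> form a closed set, so their
  infimum would itself be such a time, and \<open>step\<close> applied there gives a
  contradiction.\<close>

lemma open_set_invariant:
  fixes f :: "real \<Rightarrow> 'a :: topological_space"
  assumes f: "continuous_on {0..} f" and "open U"
    and step: "\<And>b. 0 \<le> b \<Longrightarrow> (\<And>t. 0 \<le> t \<Longrightarrow> t < b \<Longrightarrow> f t \<in> U) \<Longrightarrow> f b \<in> U"
    and "0 \<le> t"
  shows "f t \<in> U"
proof (rule ccontr)
  assume "f t \<notin> U"
  define N where "N = {0..} \<inter> f -` (- U)"
  have "closed N"
    unfolding N_def using f \<open>open U\<close> by (intro continuous_closed_preimage) auto
  moreover have "N \<noteq> {}" "bdd_below N"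
    using \<open>f t \<notin> U\<close> \<open>0 \<le> t\<close> by (auto simp: N_def intro: bdd_belowI[of _ 0])
  ultimately have "Inf N \<in> N"
    by (rule closed_contains_Inf[rotated 2])
  moreover have "f s \<in> U" if "0 \<le> s" "s < Inf N" for s
    using that cInf_lower[OF _ \<open>bdd_below N\<close>, of s] by (auto simp: N_def)
  ultimately show False
    using step[of "Inf N"] by (auto simp: N_def)
qed

subsection \<open>Global existence for globally Lipschitz equations\<close>

text \<open>Banach's fixed point theorem for \<open>g\<close>, where \<open>x t = x0 + exp (2 * L * t) *\<^sub>R g t\<close>: the
  exponential weight makes the Picard operator a contraction on the whole half-line.\<close>

lemma picard_lindelof_global:
  fixes f :: "real \<Rightarrow> 'a :: banach \<Rightarrow> 'a"
  assumes cont: "continuous_on ({0..} \<times> UNIV) (\<lambda>(t, x). f t x)"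
    and lip: "\<And>t x y. 0 \<le> t \<Longrightarrow> norm (f t x - f t y) \<le> L * norm (x - y)"
    and bdd: "\<And>t. 0 \<le> t \<Longrightarrow> norm (f t x0) \<le> K"
    and "0 < L"
  shows "\<exists>x. x 0 = x0 \<and> (\<forall>t\<ge>0. (x has_vector_derivative f t (x t)) (at t within {0..}))"
proof -
  define h where "h = (\<lambda>g s. f s (x0 + exp (2 * L * s) *\<^sub>R apply_bcontfun g s))"
  \<comment> \<open>\<open>max 0 t\<close> extends the Picard operator constantly to negative times,
    because the bounded continuous functions live on the whole line. The exponential factor undoes
    the weight.\<close>
  define \<Phi> where "\<Phi> = (\<lambda>g t. exp (- 2 * L * max 0 t) *\<^sub>R integral {0..max 0 t} (h g))"
  have K: "0 \<le> K"
    using bdd[of 0] norm_ge_zero order_trans by blast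
  have hcont: "continuous_on {0..} (h g)" for g
  proof -
    have "continuous_on {0..} (\<lambda>s. (s, x0 + exp (2 * L * s) *\<^sub>R apply_bcontfun g s))"
      by (intro continuous_intros) auto
    then have "continuous_on {0..} ((\<lambda>(t, x). f t x) \<circ>
        (\<lambda>s. (s, x0 + exp (2 * L * s) *\<^sub>R apply_bcontfun g s)))"
      by (rule continuous_on_compose) (rule continuous_on_subset[OF cont], auto)
    then show ?thesis
      by (simp add: h_def o_def)
  qed
  have hint: "h g integrable_on {0..t}" for g t
    by (intro integrable_continuous_real continuous_on_subset[OF hcont]) auto
  \<comment> \<open>One majorant serves twice: \<open>A = K\<close> for boundedness and
    \<open>A = 0\<close> for the contraction. Integrating \<open>L * exp (2 * L * s)\<close> yields
    only half the weight, which is the source of the factor 1/2.\<close>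
  have weight: "((\<lambda>s. A + B * L * exp (2 * L * s)) has_integral
      (A * t + B / 2 * exp (2 * L * t) - B / 2)) {0..t}" if "0 \<le> t" for A B t :: real
  proof -
    have "((\<lambda>s. A + B * L * exp (2 * L * s)) has_integral
        ((A * t + B / 2 * exp (2 * L * t)) - (A * 0 + B / 2 * exp (2 * L * 0)))) {0..t}"
      by (rule fundamental_theorem_of_calculus[OF that])
        (auto intro!: derivative_eq_intros simp: has_real_derivative_iff_has_vector_derivative[symmetric])
    then show ?thesis by simp
  qed
  have Phi_bcontfun: "\<Phi> g \<in> bcontfun" for g
  proof (rule bcontfun_normI)
    have "continuous_on {0..} (\<lambda>t. integral {0..t} (h g))"
      using antiderivative_halfline[OF hcont]
      by (auto simp: continuous_on_eq_continuous_within intro: has_vector_derivative_continuous)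
    then have "continuous_on UNIV (\<lambda>t. integral {0..max 0 t} (h g))"
      by (rule continuous_on_compose2) (auto intro!: continuous_intros)
    then show "continuous_on UNIV (\<Phi> g)"
      unfolding \<Phi>_def by (intro continuous_intros)
    show "norm (\<Phi> g t) \<le> K / (2 * L) + norm g / 2" for t
    proof -
      define s where "s = max 0 t"
      have s: "0 \<le> s" by (simp add: s_def)
      have "norm (integral {0..s} (h g)) \<le> integral {0..s} (\<lambda>r. K + norm g * L * exp (2 * L * r))"
      proof (rule integral_norm_bound_integral[OF hint])
        show "(\<lambda>r. K + norm g * L * exp (2 * L * r)) integrable_on {0..s}"
          using weight[OF s] by blast
        fix r assume r: "r \<in> {0..s}"
        have "norm (h g r) \<le> norm (f r x0) + norm (h g r - f r x0)"
          by (metis norm_triangle_sub)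
        also have "\<dots> \<le> K + L * norm (exp (2 * L * r) *\<^sub>R apply_bcontfun g r)"
          unfolding h_def using r lip[of r "x0 + exp (2 * L * r) *\<^sub>R apply_bcontfun g r" x0] bdd[of r]
          by (intro add_mono) auto
        also have "\<dots> \<le> K + L * (exp (2 * L * r) * norm g)"
          using \<open>0 < L\<close> by (auto intro!: mult_left_mono norm_bounded)
        finally show "norm (h g r) \<le> K + norm g * L * exp (2 * L * r)"
          by (simp add: algebra_simps)
      qed
      also have "\<dots> = K * s + norm g / 2 * exp (2 * L * s) - norm g / 2"
        using weight[OF s] by (rule integral_unique)
      \<comment> \<open>The linear growth \<open>K * s\<close> is absorbed by the weight through
        \<open>2 * L * s \<le> exp (2 * L * s)\<close>.\<close>
      also have "\<dots> \<le> (K / (2 * L) + norm g / 2) * exp (2 * L * s)"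
      proof -
        have "K / (2 * L) * (2 * L * s) \<le> K / (2 * L) * exp (2 * L * s)"
          using K \<open>0 < L\<close> exp_ge_add_one_self[of "2 * L * s"]
          by (intro mult_left_mono order_trans[OF _ exp_ge_add_one_self]) auto
        then show ?thesis
          using \<open>0 < L\<close> by (simp add: algebra_simps add_increasing)
      qed
      finally show ?thesis
        by (simp add: \<Phi>_def s_def[symmetric] exp_minus field_simps)
    qed
  qed
  define \<Psi> where "\<Psi> = (\<lambda>g. Bcontfun (\<Phi> g))"
  have Psi: "apply_bcontfun (\<Psi> g) = \<Phi> g" for g
    by (simp add: \<Psi>_def Bcontfun_inverse[OF Phi_bcontfun])
  have "dist (\<Psi> g) (\<Psi> g') \<le> 1 / 2 * dist g g'" for g g'
  proof (rule dist_bound)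
    fix t :: real
    define s where "s = max 0 t"
    have s: "0 \<le> s" by (simp add: s_def)
    have "norm (integral {0..s} (h g) - integral {0..s} (h g'))
        = norm (integral {0..s} (\<lambda>r. h g r - h g' r))"
      using hint by (simp add: integral_diff)
    also have "\<dots> \<le> integral {0..s} (\<lambda>r. 0 + dist g g' * L * exp (2 * L * r))"
    proof (rule integral_norm_bound_integral)
      show "(\<lambda>r. h g r - h g' r) integrable_on {0..s}"
        using hint by (intro integrable_diff) auto
      show "(\<lambda>r. 0 + dist g g' * L * exp (2 * L * r)) integrable_on {0..s}"
        using weight[OF s] by blast
      fix r assume r: "r \<in> {0..s}"
      have "norm (h g r - h g' r)
          \<le> L * norm (exp (2 * L * r) *\<^sub>R (apply_bcontfun g r - apply_bcontfun g' r))"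
        unfolding h_def using r
          lip[of r "x0 + exp (2 * L * r) *\<^sub>R apply_bcontfun g r"
            "x0 + exp (2 * L * r) *\<^sub>R apply_bcontfun g' r"]
        by (auto simp: scaleR_diff_right)
      also have "\<dots> \<le> L * (exp (2 * L * r) * dist g g')"
        using \<open>0 < L\<close> dist_bounded[of g r g']
        by (auto intro!: mult_left_mono simp: dist_norm)
      finally show "norm (h g r - h g' r) \<le> 0 + dist g g' * L * exp (2 * L * r)"
        by (simp add: algebra_simps)
    qed
    also have "\<dots> = 0 * s + dist g g' / 2 * exp (2 * L * s) - dist g g' / 2"
      using weight[OF s] by (rule integral_unique)
    also have "\<dots> \<le> dist g g' / 2 * exp (2 * L * s)"
      by simp
    finally have le: "norm (integral {0..s} (h g) - integral {0..s} (h g')) \<le> dist g g' / 2 * exp (2 * L * s)" .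
    have "dist (apply_bcontfun (\<Psi> g) t) (apply_bcontfun (\<Psi> g') t)
        = exp (- 2 * L * s) * norm (integral {0..s} (h g) - integral {0..s} (h g'))"
      by (simp add: Psi \<Phi>_def s_def dist_norm flip: scaleR_diff_right)
    also have "\<dots> \<le> exp (- 2 * L * s) * (dist g g' / 2 * exp (2 * L * s))"
      using le by (intro mult_left_mono) auto
    also have "\<dots> = 1 / 2 * dist g g'"
      by (simp add: exp_minus)
    finally show "dist (apply_bcontfun (\<Psi> g) t) (apply_bcontfun (\<Psi> g') t) \<le> 1 / 2 * dist g g'" .
  qed
  then obtain g where g: "\<Psi> g = g"
    using banach_fix_type[of "1 / 2" \<Psi>] by auto
  define x where "x = (\<lambda>t. x0 + integral {0..t} (h g))"
  have hx: "h g t = f t (x t)" if "0 \<le> t" for t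
  proof -
    have "apply_bcontfun g t = exp (- 2 * L * t) *\<^sub>R integral {0..t} (h g)"
      using that Psi[of g] g by (simp add: \<Phi>_def)
    then show ?thesis
      by (simp add: h_def x_def exp_minus)
  qed
  have "(x has_vector_derivative f t (x t)) (at t within {0..})" if "0 \<le> t" for t
    unfolding x_def hx[OF that, unfolded x_def, symmetric]
    by (auto intro!: derivative_eq_intros antiderivative_halfline[OF hcont that])
  moreover have "x 0 = x0"
    by (simp add: x_def)
  ultimately show ?thesis by blast
qed

subsection \<open>Two convergence criteria\<close>

text \<open>A variant of Barbalat's lemma: each time \<open>\<bar>s t\<bar> \<ge> \<epsilon>\<close>, the function \<open>W\<close> loses a fixed amount
  on the next interval of length \<open>\<epsilon> / (2 * B)\<close>.\<close>

lemma tendsto_zero_of_dissipation: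
  fixes W W' s s' :: "real \<Rightarrow> real"
  assumes W: "\<And>t. 0 < t \<Longrightarrow> (W has_real_derivative W' t) (at t)"
    and W': "\<And>t. 0 < t \<Longrightarrow> W' t \<le> - m * (s t)\<^sup>2"
    and W_nonneg: "\<And>t. 0 < t \<Longrightarrow> 0 \<le> W t"
    and s: "\<And>t. 0 < t \<Longrightarrow> (s has_real_derivative s' t) (at t)"
    and s': "\<And>t. 0 < t \<Longrightarrow> \<bar>s' t\<bar> \<le> B"
    and "0 < m" and "0 < B"
  shows "(s \<longlongrightarrow> 0) at_top"
proof (rule tendstoI)
  fix \<epsilon> :: real
  assume "0 < \<epsilon>"
  define h where "h = \<epsilon> / (2 * B)"
  define \<delta> where "\<delta> = h * (m * (\<epsilon> / 2)\<^sup>2)"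
  define I where "I = Inf (W ` {0<..})"
  have "0 < h" "0 < \<delta>"
    using \<open>0 < \<epsilon>\<close> \<open>0 < m\<close> \<open>0 < B\<close> by (auto simp: h_def \<delta>_def)
  have bdd: "bdd_below (W ` {0<..})"
    using W_nonneg by (auto intro!: bdd_belowI[of _ 0])
  have W_drop: "\<exists>z. a < z \<and> z < b \<and> W b - W a = (b - a) * W' z" if "0 < a" "a < b" for a b
    using MVT2[OF that(2), of W W'] W that by auto
  have W_mono: "W b \<le> W a" if "0 < a" "a \<le> b" for a b
  proof (cases "a < b")
    case True
    then obtain z where z: "a < z" "W b - W a = (b - a) * W' z"
      using W_drop[OF \<open>0 < a\<close>] by blast
    have "W' z \<le> 0"
      using W'[of z] z that \<open>0 < m\<close> by (smt (verit) mult_nonneg_nonneg zero_le_power2 mult_minus_left)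
    then have "(b - a) * W' z \<le> 0"
      using that by (intro mult_nonneg_nonpos) auto
    then show ?thesis using z by linarith
  qed (use that in simp)
  \<comment> \<open>From \<open>t0\<close> on, \<open>W\<close> is within \<open>\<delta>\<close> of
    its infimum, so no further loss of \<open>\<delta>\<close> is possible.\<close>
  obtain t0 where t0: "0 < t0" "W t0 < I + \<delta>"
    using cInf_lessD[of "W ` {0<..}" "I + \<delta>"] \<open>0 < \<delta>\<close> by (auto simp: I_def)
  have "dist (s t) 0 < \<epsilon>" if "t0 \<le> t" for t
  proof (rule ccontr)
    assume "\<not> dist (s t) 0 < \<epsilon>"
    then have st: "\<epsilon> \<le> \<bar>s t\<bar>" by simp
    have "0 < t"
      using that t0 by simp
    \<comment> \<open>The mean value point \<open>z\<close> carries the loss of \<open>W\<close> on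
      the interval from \<open>t\<close> to \<open>t + h\<close>; a second one, for \<open>s\<close>
      between \<open>t\<close> and \<open>z\<close>, shows
      \<open>\<bar>s z\<bar> \<ge> \<epsilon> / 2\<close>.\<close>
    obtain z where z: "t < z" "z < t + h" "W (t + h) - W t = h * W' z"
      using W_drop[OF \<open>0 < t\<close>, of "t + h"] \<open>0 < h\<close> by auto
    obtain r where r: "t < r" "r < z" "s z - s t = (z - t) * s' r"
      using MVT2[OF z(1), of s s'] s \<open>0 < t\<close> by auto
    have "\<bar>s z - s t\<bar> \<le> h * B"
      unfolding r(3) abs_mult using s'[of r] r z that t0 by (intro mult_mono) auto
    also have "h * B = \<epsilon> / 2"
      using \<open>0 < B\<close> by (simp add: h_def)
    finally have "\<epsilon> / 2 \<le> \<bar>s z\<bar>"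
      using st by linarith
    then have "m * (\<epsilon> / 2)\<^sup>2 \<le> m * (s z)\<^sup>2"
      using \<open>0 < m\<close> \<open>0 < \<epsilon>\<close> by (intro mult_left_mono) (auto simp: abs_le_square_iff[symmetric])
    then have "W' z \<le> - (m * (\<epsilon> / 2)\<^sup>2)"
      using W'[of z] z that t0 by auto
    then have "h * W' z \<le> - \<delta>"
      using mult_left_mono[of "W' z" "- (m * (\<epsilon> / 2)\<^sup>2)" h] \<open>0 < h\<close> by (simp add: \<delta>_def)
    moreover have "I \<le> W (t + h)"
      unfolding I_def using that t0 \<open>0 < h\<close> by (intro cInf_lower[OF _ bdd]) auto
    ultimately show False
      using z(3) W_mono[of t0 t] t0 that by auto
  qed
  then show "\<forall>\<^sub>F t in at_top. dist (s t) 0 < \<epsilon>"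
    by (auto simp: eventually_at_top_linorder)
qed

text \<open>If \<open>E t \<ge> \<epsilon>\<close> for a late \<open>t\<close>, then \<open>E \<ge> \<epsilon> / 2\<close> on \<open>[t, t + 1]\<close> because \<open>E'\<close> is small, so that
  \<open>s\<close> increases by a fixed amount there, contradicting \<open>s \<longlongrightarrow> 0\<close>.\<close>

lemma eventually_less_of_excitation:
  fixes E E' s a r :: "real \<Rightarrow> real"
  assumes E: "\<And>t. 0 < t \<Longrightarrow> (E has_real_derivative E' t) (at t)"
    and s: "\<And>t. 0 < t \<Longrightarrow> (s has_real_derivative a t * E t + r t) (at t)"
    and a: "\<And>t. 0 < t \<Longrightarrow> a0 \<le> a t" and "0 < a0"
    and lim: "(E' \<longlongrightarrow> 0) at_top" "(s \<longlongrightarrow> 0) at_top" "(r \<longlongrightarrow> 0) at_top"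
    and "0 < \<epsilon>"
  shows "\<forall>\<^sub>F t in at_top. E t < \<epsilon>"
proof -
  \<comment> \<open>With these thresholds the gain of \<open>s\<close> over a unit interval would
    exceed \<open>a0 * \<epsilon> / 2 - a0 * \<epsilon> / 4\<close>, whereas two values of size
    below \<open>a0 * \<epsilon> / 8\<close> differ by less than
    \<open>a0 * \<epsilon> / 4\<close>.\<close>
  have "\<forall>\<^sub>F t in at_top. \<bar>E' t\<bar> < \<epsilon> / 2" "\<forall>\<^sub>F t in at_top. \<bar>s t\<bar> < a0 * \<epsilon> / 8"
    "\<forall>\<^sub>F t in at_top. \<bar>r t\<bar> < a0 * \<epsilon> / 4"
    using tendstoD[OF lim(1), of "\<epsilon> / 2"] tendstoD[OF lim(2), of "a0 * \<epsilon> / 8"]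
      tendstoD[OF lim(3), of "a0 * \<epsilon> / 4"] \<open>0 < a0\<close> \<open>0 < \<epsilon>\<close> by auto
  then have "\<forall>\<^sub>F t in at_top. \<bar>E' t\<bar> < \<epsilon> / 2 \<and> \<bar>s t\<bar> < a0 * \<epsilon> / 8 \<and> \<bar>r t\<bar> < a0 * \<epsilon> / 4"
    by eventually_elim auto
  then obtain t1 where t1: "\<And>t. t1 \<le> t \<Longrightarrow> \<bar>E' t\<bar> < \<epsilon> / 2"
    "\<And>t. t1 \<le> t \<Longrightarrow> \<bar>s t\<bar> < a0 * \<epsilon> / 8" "\<And>t. t1 \<le> t \<Longrightarrow> \<bar>r t\<bar> < a0 * \<epsilon> / 4"
    by (auto simp: eventually_at_top_linorder)
  have "E t < \<epsilon>" if t: "max 1 t1 \<le> t" for t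
  proof (rule ccontr)
    assume "\<not> E t < \<epsilon>"
    obtain z where z: "t < z" "z < t + 1" "s (t + 1) - s t = a z * E z + r z"
      using MVT2[of t "t + 1" s "\<lambda>t. a t * E t + r t"] s t by auto
    obtain q where q: "t < q" "q < z" "E z - E t = (z - t) * E' q"
      using MVT2[OF z(1), of E E'] E t by auto
    have "\<bar>(z - t) * E' q\<bar> \<le> 1 * (\<epsilon> / 2)"
      unfolding abs_mult using z q t t1(1)[of q] by (intro mult_mono) auto
    then have "\<epsilon> / 2 \<le> E z"
      using q \<open>\<not> E t < \<epsilon>\<close> by linarith
    then have "a0 * (\<epsilon> / 2) \<le> a z * E z"
      using a[of z] z t \<open>0 < a0\<close> \<open>0 < \<epsilon>\<close> by (intro mult_mono) auto
    then show False
      using z t1(2)[of t] t1(2)[of "t + 1"] t1(3)[of z] t by simp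
  qed
  then show ?thesis
    unfolding eventually_at_top_linorder by blast
qed

text \<open>The hypotheses are symmetric under changing the signs of \<open>E\<close>,
  \<open>s\<close> and \<open>r\<close> together, so the one-sided bound applies to \<open>E\<close>
  and to \<open>- E\<close>.\<close>

lemma tendsto_zero_of_excitation:
  fixes E E' s a r :: "real \<Rightarrow> real"
  assumes E: "\<And>t. 0 < t \<Longrightarrow> (E has_real_derivative E' t) (at t)"
    and s: "\<And>t. 0 < t \<Longrightarrow> (s has_real_derivative a t * E t + r t) (at t)"
    and a: "\<And>t. 0 < t \<Longrightarrow> a0 \<le> a t" "0 < a0"
    and lim: "(E' \<longlongrightarrow> 0) at_top" "(s \<longlongrightarrow> 0) at_top" "(r \<longlongrightarrow> 0) at_top"
  shows "(E \<longlongrightarrow> 0) at_top"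
proof (rule tendstoI)
  fix \<epsilon> :: real
  assume "0 < \<epsilon>"
  have "\<forall>\<^sub>F t in at_top. E t < \<epsilon>"
    by (rule eventually_less_of_excitation[OF E s a lim \<open>0 < \<epsilon>\<close>])
  moreover have "\<forall>\<^sub>F t in at_top. - E t < \<epsilon>"
  proof (rule eventually_less_of_excitation[OF _ _ a _ _ _ \<open>0 < \<epsilon>\<close>])
    show "((\<lambda>t. - E t) has_real_derivative - E' t) (at t)" if "0 < t" for t
      using E[OF that] by (rule DERIV_minus)
    show "((\<lambda>t. - s t) has_real_derivative a t * - E t + - r t) (at t)" if "0 < t" for t
      using DERIV_minus[OF s[OF that]] by simp
  qed (use lim in \<open>auto intro: tendsto_minus_cancel\<close>)
  ultimately show "\<forall>\<^sub>F t in at_top. dist (E t) 0 < \<epsilon>"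
    by eventually_elim (simp add: abs_less_iff)
qed

subsection \<open>The reduced observer\<close>

text \<open>Here \<open>y\<close> stands for the estimate of \<open>X\<^sub>i\<^sub>n = \<xi>\<close>, \<open>s\<close> for the temperature error, \<open>u\<close> for the
  ratio of the estimates of \<open>X\<close> and \<open>X\<^sub>i\<^sub>n\<close>, and \<open>d\<close> for the error of that ratio.\<close>

locale reduced_observer =
  fixes \<alpha> e0 u0 u1 d0 c \<beta> \<kappa> \<xi> :: real and e u d :: "real \<Rightarrow> real"
  assumes pos: "0 < \<alpha>" "0 < e0" "0 < u0" "0 \<le> d0" "0 < c" "0 < \<beta>" "0 < \<kappa>" "0 < \<xi>"
    and e: "\<And>t. 0 \<le> t \<Longrightarrow> e0 \<le> e t" "\<And>t. 0 \<le> t \<Longrightarrow> e t \<le> 1"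
    and u: "\<And>t. 0 \<le> t \<Longrightarrow> u0 \<le> u t" "\<And>t. 0 \<le> t \<Longrightarrow> u t \<le> u1"
    and d: "\<And>t. 0 \<le> t \<Longrightarrow> \<bar>d t\<bar> \<le> d0 * exp (- \<alpha> * t)"
    and cont: "continuous_on {0..} e" "continuous_on {0..} u" "continuous_on {0..} d"
begin

text \<open>These are the equations for the estimate of the inlet composition and for the
  temperature error once the estimate of \<open>X\<close> is written as \<open>u * y\<close> and
  \<open>X\<close> itself as \<open>\<xi> * (u - d)\<close>.\<close>

definition y_rhs :: "real \<Rightarrow> real \<Rightarrow> real \<Rightarrow> real" where
  "y_rhs t y s = - \<beta> * e t * c * u t * s * y\<^sup>2"

definition s_rhs :: "real \<Rightarrow> real \<Rightarrow> real \<Rightarrow> real" where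
  "s_rhs t y s = e t * c * (u t * y * (1 - \<kappa> * s) - \<xi> * (u t - d t))"

definition trajectory :: "(real \<Rightarrow> real) \<Rightarrow> (real \<Rightarrow> real) \<Rightarrow> bool" where
  "trajectory y s \<longleftrightarrow> (\<forall>t\<ge>0. (y has_real_derivative y_rhs t (y t) (s t)) (at t within {0..}) \<and>
     (s has_real_derivative s_rhs t (y t) (s t)) (at t within {0..}))"

text \<open>The logarithmic term is a barrier: it blows up both as \<open>y\<close> tends to 0 and
  as \<open>y\<close> tends to infinity, so sublevel sets are compact in the half-plane
  \<open>y > 0\<close>.\<close>

definition V :: "real \<Rightarrow> real \<Rightarrow> real" where
  "V y s = s\<^sup>2 / 2 + (\<xi> / y - 1 - ln (\<xi> / y)) / \<beta>"

text \<open>The weight compensates the term \<open>e t * c * \<xi> * d t * s\<close> in the derivative of \<open>V\<close>.\<close>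

definition W :: "real \<Rightarrow> real \<Rightarrow> real \<Rightarrow> real" where
  "W t y s = (1 + V y s) * exp (c * \<xi> * d0 / \<alpha> * exp (- \<alpha> * t))"

text \<open>This is the value of \<open>W\<close> at time 0, which will bound \<open>1 + V\<close>
  for all later times.\<close>

definition level :: "real \<Rightarrow> real \<Rightarrow> real" where
  "level y s = (1 + V y s) * exp (c * \<xi> * d0 / \<alpha>)"

text \<open>An explicit open box around the sublevel set \<open>V \<le> C\<close>. Openness serves
  the exit time argument, the product form the clamping of coordinates.\<close>

definition trap_box :: "real \<Rightarrow> (real \<times> real) set" where
  "trap_box C = {\<xi> / (2 * (\<beta> * C + 1)) <..< \<xi> * exp (\<beta> * C + 1)} \<times> {- (C + 1) <..< C + 1}"

section \<open>Lyapunov estimates and the trapping box\<close>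

lemma e_pos: "0 \<le> t \<Longrightarrow> 0 < e t" and u_pos: "0 \<le> t \<Longrightarrow> 0 < u t"
  using e(1)[of t] u(1)[of t] pos by auto

lemma d_le: "0 \<le> t \<Longrightarrow> \<bar>d t\<bar> \<le> d0"
  using d[of t] pos by (smt (verit) exp_le_one_iff mult_left_le mult_nonneg_nonneg mult_minus_left)

lemma V_lower: "s\<^sup>2 / 2 \<le> V y s" if "0 < y"
  using ln_le_minus_one[of "\<xi> / y"] that pos by (simp add: V_def)

lemma V_nonneg: "0 \<le> V y s" if "0 < y"
  using V_lower[OF that, of s] by (smt (verit) zero_le_power2 divide_nonneg_pos)

lemma level_ge: "1 + V y s \<le> level y s" if "0 < y"
proof -
  have "1 \<le> exp (c * \<xi> * d0 / \<alpha>)"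
    using pos by simp
  then show ?thesis
    using mult_left_mono[of 1 "exp (c * \<xi> * d0 / \<alpha>)" "1 + V y s"] V_nonneg[OF that]
    by (simp add: level_def)
qed

lemma trap_box_if_V_le: "(y, s) \<in> trap_box C" if "0 < y" "V y s \<le> C"
proof -
  define z where "z = \<xi> / y"
  have z: "0 < z"
    using that pos by (simp add: z_def)
  have "0 \<le> C"
    using V_nonneg[OF that(1)] that(2) order_trans by blast
  have "\<bar>s\<bar> \<le> (1 + s\<^sup>2) / 2"
    using zero_le_power2[of "\<bar>s\<bar> - 1"] by (simp add: power2_diff)
  then have s: "\<bar>s\<bar> < C + 1"
    using V_lower[OF that(1), of s] that(2) by simp
  have "(z - 1 - ln z) / \<beta> \<le> C"
    using that(2) zero_le_power2[of s] unfolding V_def z_def by linarith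
  then have phi: "z - 1 - ln z \<le> \<beta> * C"
    using pos by (simp add: field_simps)
  \<comment> \<open>The logarithm is estimated at \<open>z / 2\<close> rather than at
    \<open>z\<close>, so that half of the linear term in \<open>z - 1 - ln z\<close> survives and
    bounds \<open>z\<close> from above.\<close>
  have "ln z = ln (z / 2) + ln 2"
    using z by (simp add: ln_div)
  also have "\<dots> < z / 2 - 1 + 1"
    using ln_le_minus_one[of "z / 2"] z ln_2_less_1 by (intro add_le_less_mono) auto
  finally have "z < 2 * (\<beta> * C + 1)"
    using phi by simp
  then have lo: "\<xi> / (2 * (\<beta> * C + 1)) < y"
    using that(1) pos \<open>0 \<le> C\<close> by (simp add: z_def field_simps add_pos_nonneg)
  have "- ln z < \<beta> * C + 1"
    using phi z by simp
  then have "exp (ln (y / \<xi>)) < exp (\<beta> * C + 1)"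
    using pos that(1) by (simp add: z_def ln_div)
  then have "y < \<xi> * exp (\<beta> * C + 1)"
    using pos that(1) by (simp add: field_simps)
  then show ?thesis
    using lo s by (simp add: trap_box_def abs_less_iff)
qed

text \<open>The logarithmic part of \<open>V\<close> is chosen so that its derivative
  \<open>(\<xi> - y) * (e * c * u * s)\<close> cancels the cross term of \<open>s * s_rhs\<close>.
  Only the damping and the contribution of \<open>d\<close> remain.\<close>

lemma V_deriv:
  assumes "0 < t" and y: "(y has_real_derivative y_rhs t (y t) (s t)) (at t)"
    and s: "(s has_real_derivative s_rhs t (y t) (s t)) (at t)" and "0 < y t"
  shows "((\<lambda>t. V (y t) (s t)) has_real_derivative
    e t * c * \<xi> * d t * s t - \<kappa> * e t * c * u t * y t * (s t)\<^sup>2) (at t)"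
proof -
  have "((\<lambda>t. V (y t) (s t)) has_real_derivative
      s t * s_rhs t (y t) (s t) + (1 / y t - \<xi> / (y t)\<^sup>2) * y_rhs t (y t) (s t) / \<beta>) (at t)"
    unfolding V_def using pos \<open>0 < y t\<close>
    by (auto intro!: derivative_eq_intros y s simp: field_simps power2_eq_square)
  moreover have "(1 / y t - \<xi> / (y t)\<^sup>2) * y_rhs t (y t) (s t) / \<beta> = (\<xi> - y t) * (e t * c * u t * s t)"
    using pos \<open>0 < y t\<close> by (simp add: y_rhs_def field_simps power2_eq_square)
  ultimately show ?thesis
    by (simp add: s_rhs_def algebra_simps power2_eq_square)
qed

text \<open>Since \<open>\<bar>s\<bar> \<le> 1 + V\<close>, the contribution of \<open>d\<close> is
  at most \<open>c * \<xi> * d0 * exp (- \<alpha> * t) * (1 + V)\<close>, exactly what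
  differentiating the weight takes away. In the proof, \<open>q\<close> is the derivative of
  \<open>W\<close> divided by the weight \<open>G\<close>.\<close>

lemma W_deriv:
  assumes "0 < t" and y: "(y has_real_derivative y_rhs t (y t) (s t)) (at t)"
    and s: "(s has_real_derivative s_rhs t (y t) (s t)) (at t)" and "0 < y t"
  obtains w where "((\<lambda>t. W t (y t) (s t)) has_real_derivative w) (at t)"
    and "w \<le> - (\<kappa> * e0 * c * u0 * y t) * (s t)\<^sup>2"
proof -
  define v where "v = e t * c * \<xi> * d t * s t - \<kappa> * e t * c * u t * y t * (s t)\<^sup>2"
  define G where "G = exp (c * \<xi> * d0 / \<alpha> * exp (- \<alpha> * t))"
  define q where "q = v - c * \<xi> * d0 * exp (- \<alpha> * t) * (1 + V (y t) (s t))"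
  have W: "((\<lambda>t. W t (y t) (s t)) has_real_derivative q * G) (at t)"
    unfolding W_def q_def v_def G_def using pos
    by (auto intro!: derivative_eq_intros V_deriv[OF assms] simp: field_simps)
  have "\<bar>s t\<bar> \<le> (1 + (s t)\<^sup>2) / 2"
    using zero_le_power2[of "\<bar>s t\<bar> - 1"] by (simp add: power2_diff)
  then have sV: "\<bar>s t\<bar> \<le> 1 + V (y t) (s t)"
    using V_lower[OF \<open>0 < y t\<close>, of "s t"] by simp
  have "e t * c * \<xi> * d t * s t \<le> c * \<xi> * (e t * \<bar>d t\<bar>) * \<bar>s t\<bar>"
  proof -
    have "d t * s t \<le> \<bar>d t\<bar> * \<bar>s t\<bar>"
      by (metis abs_ge_self abs_mult)
    then have "(e t * c * \<xi>) * (d t * s t) \<le> (e t * c * \<xi>) * (\<bar>d t\<bar> * \<bar>s t\<bar>)"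
      using e_pos[of t] pos \<open>0 < t\<close> by (intro mult_left_mono) auto
    then show ?thesis by (simp add: mult_ac)
  qed
  also have "\<dots> \<le> c * \<xi> * (1 * (d0 * exp (- \<alpha> * t))) * (1 + V (y t) (s t))"
  proof -
    have "e t * \<bar>d t\<bar> \<le> 1 * (d0 * exp (- \<alpha> * t))"
      using e[of t] e_pos[of t] d[of t] \<open>0 < t\<close> by (intro mult_mono) auto
    then show ?thesis
      using pos sV e_pos[of t] \<open>0 < t\<close> by (intro mult_mono[OF mult_left_mono]) auto
  qed
  finally have q: "q \<le> - (\<kappa> * e t * c * u t * y t * (s t)\<^sup>2)"
    by (simp add: q_def v_def mult_ac)
  also have "\<dots> \<le> - (\<kappa> * e0 * c * u0 * y t * (s t)\<^sup>2)"
  proof -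
    have "e0 * u0 \<le> e t * u t"
      using pos e(1)[of t] u(1)[of t] \<open>0 < t\<close> by (intro mult_mono) auto
    then have "(\<kappa> * c * y t * (s t)\<^sup>2) * (e0 * u0) \<le> (\<kappa> * c * y t * (s t)\<^sup>2) * (e t * u t)"
      using pos \<open>0 < y t\<close> by (intro mult_left_mono) auto
    then show ?thesis by (simp add: mult_ac)
  qed
  finally have q0: "q \<le> - (\<kappa> * e0 * c * u0 * y t) * (s t)\<^sup>2"
    by simp
  also have "\<dots> \<le> 0"
    using pos \<open>0 < y t\<close> by simp
  \<comment> \<open>Since \<open>q \<le> 0\<close> and \<open>G \<ge> 1\<close>, restoring the
    weight only strengthens the bound.\<close>
  finally have "q * G \<le> q * 1"
    using pos by (intro mult_left_mono_neg) (auto simp: G_def)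
  then show thesis
    using that[OF W] q0 by simp
qed

text \<open>\<open>W\<close> decreases from its initial value \<open>level (y 0) (s 0)\<close> and
  dominates \<open>1 + V\<close>. The equations are assumed only strictly before \<open>b\<close>,
  the information available at a potential first exit time.\<close>

lemma trap_box_invariant:
  assumes "0 \<le> b" and cont_ys: "continuous_on {0..b} y" "continuous_on {0..b} s"
    and y: "\<And>t. 0 < t \<Longrightarrow> t < b \<Longrightarrow> (y has_real_derivative y_rhs t (y t) (s t)) (at t)"
    and s: "\<And>t. 0 < t \<Longrightarrow> t < b \<Longrightarrow> (s has_real_derivative s_rhs t (y t) (s t)) (at t)"
    and y_pos: "\<And>t. 0 \<le> t \<Longrightarrow> t \<le> b \<Longrightarrow> 0 < y t"
  shows "(y b, s b) \<in> trap_box (level (y 0) (s 0))"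
proof -
  have "W b (y b) (s b) \<le> W 0 (y 0) (s 0)"
  proof (rule DERIV_nonpos_imp_decreasing_open[OF \<open>0 \<le> b\<close>])
    show "\<exists>w. ((\<lambda>t. W t (y t) (s t)) has_real_derivative w) (at t) \<and> w \<le> 0" if t: "0 < t" "t < b" for t
    proof -
      have "0 < y t" using y_pos[of t] t by simp
      moreover have "- (\<kappa> * e0 * c * u0 * y t) * (s t)\<^sup>2 \<le> 0"
        using pos \<open>0 < y t\<close> by simp
      ultimately show ?thesis
        using W_deriv[OF t(1) y[OF t] s[OF t]] by (metis order_trans)
    qed
    have "y t \<noteq> 0" if "t \<in> {0..b}" for t
      using y_pos[of t] that by auto
    then show "continuous_on {0..b} (\<lambda>t. W t (y t) (s t))"
      unfolding W_def V_def using pos by (auto intro!: continuous_intros cont_ys)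
  qed
  moreover have "1 + V (y b) (s b) \<le> W b (y b) (s b)"
    using V_nonneg[OF y_pos[OF \<open>0 \<le> b\<close>], of "s b"] pos
      mult_left_mono[of 1 "exp (c * \<xi> * d0 / \<alpha> * exp (- \<alpha> * b))" "1 + V (y b) (s b)"]
    by (simp add: W_def)
  ultimately have "V (y b) (s b) \<le> level (y 0) (s 0)"
    by (simp add: W_def level_def)
  then show ?thesis
    using y_pos[of b] \<open>0 \<le> b\<close> by (intro trap_box_if_V_le) auto
qed

section \<open>Bounds, existence and convergence for the reduced observer\<close>

lemma trajectory_continuous:
  assumes "trajectory y s"
  shows "continuous_on {0..} y" "continuous_on {0..} s"
  using assms unfolding trajectory_def
  by (auto intro!: has_derivative_imp_continuous_halfline)

lemma trajectory_deriv:
  assumes "trajectory y s" "0 < t"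
  shows "(y has_real_derivative y_rhs t (y t) (s t)) (at t)"
    and "(s has_real_derivative s_rhs t (y t) (s t)) (at t)"
  using assms by (auto simp: trajectory_def at_within_halfline[of t, symmetric])

lemma eu_bounds: "0 \<le> e t * u t" "e t * u t \<le> u1" if "0 \<le> t"
proof -
  show "0 \<le> e t * u t"
    using e_pos[OF that] u_pos[OF that] by simp
  have "e t * u t \<le> 1 * u1"
    using e[OF that] u[OF that] e_pos[OF that] u_pos[OF that] by (intro mult_mono) auto
  then show "e t * u t \<le> u1" by simp
qed

lemma u1_pos: "0 < u1"
  using u[of 0] pos by auto

lemma d_tendsto_zero: "(d \<longlongrightarrow> 0) at_top"
proof (rule Lim_null_comparison)
  show "\<forall>\<^sub>F t in at_top. norm (d t) \<le> d0 * exp (- \<alpha> * t)"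
    using eventually_ge_at_top[of 0] by eventually_elim (use d in auto)
  have "filterlim (\<lambda>t. - \<alpha> * t) at_bot at_top"
    using pos by (intro filterlim_tendsto_neg_mult_at_bot[OF tendsto_const _ filterlim_ident]) auto
  then have "((\<lambda>t. exp (- \<alpha> * t)) \<longlongrightarrow> 0) at_top"
    by (rule filterlim_compose[OF exp_at_bot])
  then show "((\<lambda>t. d0 * exp (- \<alpha> * t)) \<longlongrightarrow> 0) at_top"
    by (rule tendsto_mult_right_zero)
qed

text \<open>The bounds on the right-hand sides serve twice: at the initial state for Picard
  iteration, and along trajectories. The factor \<open>\<bar>s\<bar>\<close> here makes the
  derivative of \<open>y\<close> vanish in the limit together with \<open>s\<close>.\<close>

lemma y_rhs_bound:
  assumes "0 \<le> t" "0 \<le> y" "y \<le> h"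
  shows "\<bar>y_rhs t y s\<bar> \<le> \<beta> * c * u1 * h\<^sup>2 * \<bar>s\<bar>"
proof -
  have A: "0 \<le> \<beta> * c * (e t * u t) * y\<^sup>2"
    using eu_bounds(1)[OF \<open>0 \<le> t\<close>] pos by simp
  have "\<bar>y_rhs t y s\<bar> = \<bar>- (\<beta> * c * (e t * u t) * y\<^sup>2 * s)\<bar>"
    by (simp add: y_rhs_def mult_ac)
  also have "\<dots> = \<beta> * c * (e t * u t) * y\<^sup>2 * \<bar>s\<bar>"
    unfolding abs_minus_cancel abs_mult[of _ s] abs_of_nonneg[OF A] ..
  also have "\<dots> \<le> \<beta> * c * u1 * h\<^sup>2 * \<bar>s\<bar>"
  proof (intro mult_right_mono[OF mult_mono[OF mult_left_mono]])
    show "y\<^sup>2 \<le> h\<^sup>2"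
      using assms by (intro power_mono) auto
  qed (use pos u1_pos eu_bounds[OF \<open>0 \<le> t\<close>] in auto)
  finally show ?thesis .
qed

lemma s_rhs_bound:
  assumes "0 \<le> t" "0 \<le> y" "y \<le> h" "\<bar>s\<bar> \<le> B"
  shows "\<bar>s_rhs t y s\<bar> \<le> c * (u1 * (h * (1 + \<kappa> * B)) + \<xi> * (u1 + d0))"
proof -
  have "\<bar>\<kappa> * s\<bar> \<le> \<kappa> * B"
    using assms(4) pos by (simp add: abs_mult)
  then have "\<bar>1 - \<kappa> * s\<bar> \<le> 1 + \<kappa> * B"
    by linarith
  then have "\<bar>e t * u t\<bar> * (\<bar>y\<bar> * \<bar>1 - \<kappa> * s\<bar>) \<le> u1 * (h * (1 + \<kappa> * B))"
    using assms eu_bounds[OF \<open>0 \<le> t\<close>] u1_pos by (intro mult_mono) auto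
  moreover have "\<bar>e t\<bar> * (\<xi> * \<bar>u t - d t\<bar>) \<le> 1 * (\<xi> * (u1 + d0))"
    using e[OF \<open>0 \<le> t\<close>] u[OF \<open>0 \<le> t\<close>] u_pos[OF \<open>0 \<le> t\<close>] e_pos[OF \<open>0 \<le> t\<close>] d_le[OF \<open>0 \<le> t\<close>] pos
    by (intro mult_mono) auto
  moreover have "\<bar>(e t * u t) * (y * (1 - \<kappa> * s)) - e t * (\<xi> * (u t - d t))\<bar>
      \<le> \<bar>e t * u t\<bar> * (\<bar>y\<bar> * \<bar>1 - \<kappa> * s\<bar>) + \<bar>e t\<bar> * (\<xi> * \<bar>u t - d t\<bar>)"
    using pos by (intro order_trans[OF abs_triangle_ineq4]) (simp add: abs_mult)
  ultimately have le: "\<bar>(e t * u t) * (y * (1 - \<kappa> * s)) - e t * (\<xi> * (u t - d t))\<bar>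
      \<le> u1 * (h * (1 + \<kappa> * B)) + \<xi> * (u1 + d0)"
    by linarith
  have "s_rhs t y s = c * ((e t * u t) * (y * (1 - \<kappa> * s)) - e t * (\<xi> * (u t - d t)))"
    by (simp add: s_rhs_def algebra_simps)
  then have "\<bar>s_rhs t y s\<bar> = c * \<bar>(e t * u t) * (y * (1 - \<kappa> * s)) - e t * (\<xi> * (u t - d t))\<bar>"
    using pos(5) by (metis abs_mult abs_of_pos)
  then show ?thesis
    using le pos(5) by simp
qed

text \<open>The right-hand side is made globally Lipschitz by clamping the state to the box of the initial
  state; the clamped solution never leaves that box, so it solves the original equations.\<close>

theorem trajectory_exists:
  assumes "0 < y0"
  shows "\<exists>y s. trajectory y s \<and> y 0 = y0 \<and> s 0 = s0"
proof -
  define C where "C = level y0 s0"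
  define lo where "lo = \<xi> / (2 * (\<beta> * C + 1))"
  define hi where "hi = \<xi> * exp (\<beta> * C + 1)"
  define B where "B = C + 1"
  \<comment> \<open>\<open>p\<close> and \<open>q\<close> project onto the closed box: they are
    1-Lipschitz and fix the coordinates of every point of \<open>trap_box C\<close>.\<close>
  define p where "p = (\<lambda>y. max lo (min hi y))"
  define q where "q = (\<lambda>s. max (- B) (min B s))"
  define F where "F = (\<lambda>t x. (y_rhs t (p (fst x)) (q (snd x)), s_rhs t (p (fst x)) (q (snd x))))"
  have C: "1 \<le> C"
    using level_ge[OF assms, of s0] V_nonneg[OF assms, of s0] by (simp add: C_def)
  then have "0 < lo" "0 < B"
    using pos by (auto simp: lo_def B_def intro!: divide_pos_pos add_pos_pos mult_pos_pos)
  have start: "(y0, s0) \<in> trap_box C"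
    using level_ge[OF assms, of s0] by (intro trap_box_if_V_le assms) (simp add: C_def)
  then have "lo < hi"
    by (auto simp: trap_box_def lo_def hi_def)
  have p: "lo \<le> p y" "p y \<le> hi" "\<bar>p y - p y'\<bar> \<le> \<bar>y - y'\<bar>" for y y'
    using \<open>lo < hi\<close> by (auto simp: p_def)
  have q: "\<bar>q s\<bar> \<le> B" "\<bar>q s - q s'\<bar> \<le> \<bar>s - s'\<bar>" for s s'
    using \<open>0 < B\<close> by (auto simp: q_def)
  \<comment> \<open>Lipschitz constants of \<open>s * y\<^sup>2\<close> and
    \<open>y * (1 - \<kappa> * s)\<close> on the box, multiplied by bounds for their
    coefficients.\<close>
  define L1 where "L1 = \<beta> * c * u1 * (hi\<^sup>2 + B * (2 * hi))"
  define L2 where "L2 = c * u1 * ((1 + \<kappa> * B) + hi * \<kappa>)"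
  have lip1: "\<bar>y_rhs t (p y) (q s) - y_rhs t (p y') (q s')\<bar> \<le> L1 * N"
    if "0 \<le> t" "\<bar>y - y'\<bar> \<le> N" "\<bar>s - s'\<bar> \<le> N" for t y y' s s' N
  proof -
    have "\<bar>q s * (p y)\<^sup>2 - q s' * (p y')\<^sup>2\<bar>
        = \<bar>(q s - q s') * (p y)\<^sup>2 + q s' * ((p y - p y') * (p y + p y'))\<bar>"
      by (simp add: power2_eq_square algebra_simps)
    also have "\<dots> \<le> \<bar>q s - q s'\<bar> * (p y)\<^sup>2 + \<bar>q s'\<bar> * (\<bar>p y - p y'\<bar> * \<bar>p y + p y'\<bar>)"
      by (rule order_trans[OF abs_triangle_ineq]) (simp add: abs_mult)
    also have "\<dots> \<le> N * hi\<^sup>2 + B * (N * (2 * hi))"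
    proof (intro add_mono mult_mono)
      show "(p y)\<^sup>2 \<le> hi\<^sup>2"
        using p(1,2)[of y] \<open>0 < lo\<close> by (intro power_mono) auto
    qed (use that p(1,2)[of y] p(1,2)[of y'] p(3)[of y y'] q(1)[of s'] q(2)[of s s'] \<open>0 < lo\<close> \<open>0 < B\<close>
        in auto)
    finally have le: "\<bar>q s * (p y)\<^sup>2 - q s' * (p y')\<^sup>2\<bar> \<le> N * (hi\<^sup>2 + B * (2 * hi))"
      by (simp add: algebra_simps)
    have "\<bar>y_rhs t (p y) (q s) - y_rhs t (p y') (q s')\<bar>
        = \<bar>- (\<beta> * c * (e t * u t) * (q s * (p y)\<^sup>2 - q s' * (p y')\<^sup>2))\<bar>"
      by (simp add: y_rhs_def algebra_simps)
    also have "\<dots> = \<beta> * c * (e t * u t) * \<bar>q s * (p y)\<^sup>2 - q s' * (p y')\<^sup>2\<bar>"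
      unfolding abs_minus_cancel using eu_bounds(1)[OF that(1)] pos
      by (intro abs_mult_nonneg_left) auto
    also have "\<dots> \<le> \<beta> * c * u1 * (N * (hi\<^sup>2 + B * (2 * hi)))"
      using eu_bounds[OF that(1)] pos le u1_pos by (intro mult_mono[OF mult_left_mono]) auto
    finally show ?thesis
      by (simp add: L1_def mult_ac)
  qed
  have lip2: "\<bar>s_rhs t (p y) (q s) - s_rhs t (p y') (q s')\<bar> \<le> L2 * N"
    if "0 \<le> t" "\<bar>y - y'\<bar> \<le> N" "\<bar>s - s'\<bar> \<le> N" for t y y' s s' N
  proof -
    have q': "\<bar>1 - \<kappa> * q s\<bar> \<le> 1 + \<kappa> * B"
    proof -
      have "\<bar>\<kappa> * q s\<bar> \<le> \<kappa> * B"
        using q(1)[of s] pos by (simp add: abs_mult)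
      then show ?thesis by linarith
    qed
    have "\<bar>p y * (1 - \<kappa> * q s) - p y' * (1 - \<kappa> * q s')\<bar>
        = \<bar>(p y - p y') * (1 - \<kappa> * q s) + p y' * (\<kappa> * (q s' - q s))\<bar>"
      by (simp add: algebra_simps)
    also have "\<dots> \<le> \<bar>p y - p y'\<bar> * \<bar>1 - \<kappa> * q s\<bar> + \<bar>p y'\<bar> * (\<kappa> * \<bar>q s' - q s\<bar>)"
      by (rule order_trans[OF abs_triangle_ineq]) (use pos in \<open>simp add: abs_mult\<close>)
    also have "\<dots> \<le> N * (1 + \<kappa> * B) + hi * (\<kappa> * N)"
      using that p(1,2)[of y'] p(3)[of y y'] q(2)[of s' s] q' \<open>0 < lo\<close> \<open>0 < B\<close> pos
      by (intro add_mono mult_mono) auto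
    finally have le: "\<bar>p y * (1 - \<kappa> * q s) - p y' * (1 - \<kappa> * q s')\<bar> \<le> N * ((1 + \<kappa> * B) + hi * \<kappa>)"
      by (simp add: algebra_simps)
    have "\<bar>s_rhs t (p y) (q s) - s_rhs t (p y') (q s')\<bar>
        = \<bar>c * (e t * u t) * (p y * (1 - \<kappa> * q s) - p y' * (1 - \<kappa> * q s'))\<bar>"
      by (simp add: s_rhs_def algebra_simps)
    also have "\<dots> = c * (e t * u t) * \<bar>p y * (1 - \<kappa> * q s) - p y' * (1 - \<kappa> * q s')\<bar>"
      using eu_bounds(1)[OF that(1)] pos by (intro abs_mult_nonneg_left) auto
    also have "\<dots> \<le> c * u1 * (N * ((1 + \<kappa> * B) + hi * \<kappa>))"
      using eu_bounds[OF that(1)] pos le u1_pos by (intro mult_mono[OF mult_left_mono]) auto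
    finally show ?thesis
      by (simp add: L2_def mult_ac)
  qed
  have "0 < hi"
    using \<open>0 < lo\<close> \<open>lo < hi\<close> by simp
  have pq_cont: "continuous_on A (\<lambda>x. p (f x))" "continuous_on A (\<lambda>x. q (f x))"
    if "continuous_on A f" for A and f :: "real \<times> real \<times> real \<Rightarrow> real"
    unfolding p_def q_def by (intro continuous_intros that)+
  have coeff_cont: "continuous_on ({0..} \<times> UNIV) (\<lambda>x :: real \<times> real \<times> real. g (fst x))"
    if "continuous_on {0..} g" for g :: "real \<Rightarrow> real"
    by (rule continuous_on_compose2[OF that]) (auto intro!: continuous_intros)
  have "\<exists>x. x 0 = (y0, s0) \<and> (\<forall>t\<ge>0. (x has_vector_derivative F t (x t)) (at t within {0..}))"
  proof (rule picard_lindelof_global)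
    show "continuous_on ({0..} \<times> UNIV) (\<lambda>(t, x). F t x)"
      unfolding F_def y_rhs_def s_rhs_def case_prod_beta
      by (intro continuous_intros pq_cont coeff_cont cont)
    show "norm (F t x - F t x') \<le> (L1 + L2) * norm (x - x')" if "0 \<le> t" for t x x'
    proof -
      have "x - x' = (fst x - fst x', snd x - snd x')"
        by (simp add: prod_eq_iff)
      then have "\<bar>fst x - fst x'\<bar> \<le> norm (x - x')" "\<bar>snd x - snd x'\<bar> \<le> norm (x - x')"
        using norm_fst_le[of "fst x - fst x'" "snd x - snd x'"]
          norm_snd_le[of "snd x - snd x'" "fst x - fst x'"] by simp_all
      then have "norm (F t x - F t x') \<le> L1 * norm (x - x') + L2 * norm (x - x')"
        unfolding F_def diff_Pair
        by (intro order_trans[OF norm_Pair_le] add_mono) (auto intro!: lip1 lip2 that)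
      then show ?thesis by (simp add: algebra_simps)
    qed
    show "0 < L1 + L2"
      unfolding L1_def L2_def using pos u1_pos \<open>0 < hi\<close> \<open>0 < B\<close>
      by (intro add_pos_pos mult_pos_pos) auto
    show "norm (F t (y0, s0)) \<le> \<beta> * c * u1 * hi\<^sup>2 * B
        + c * (u1 * (hi * (1 + \<kappa> * B)) + \<xi> * (u1 + d0))" if "0 \<le> t" for t
    proof -
      have "\<bar>y_rhs t (p y0) (q s0)\<bar> \<le> \<beta> * c * u1 * hi\<^sup>2 * \<bar>q s0\<bar>"
        using p(1,2)[of y0] \<open>0 < lo\<close> that by (intro y_rhs_bound) auto
      also have "\<dots> \<le> \<beta> * c * u1 * hi\<^sup>2 * B"
        using q(1)[of s0] pos u1_pos by (intro mult_left_mono) auto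
      finally show ?thesis
        unfolding F_def using p(1,2)[of y0] q(1)[of s0] \<open>0 < lo\<close> that
        by (intro order_trans[OF norm_Pair_le] add_mono) (auto intro!: s_rhs_bound)
    qed
  qed
  then obtain x where x: "x 0 = (y0, s0)"
    "\<And>t. 0 \<le> t \<Longrightarrow> (x has_vector_derivative F t (x t)) (at t within {0..})"
    by blast
  define y where "y = (\<lambda>t. fst (x t))"
  define s where "s = (\<lambda>t. snd (x t))"
  have ys: "(y has_real_derivative y_rhs t (p (y t)) (q (s t))) (at t within {0..})"
    "(s has_real_derivative s_rhs t (p (y t)) (q (s t))) (at t within {0..})" if "0 \<le> t" for t
    using bounded_linear.has_vector_derivative[OF bounded_linear_fst x(2)[OF that]]
      bounded_linear.has_vector_derivative[OF bounded_linear_snd x(2)[OF that]]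
    by (simp_all add: y_def s_def F_def has_real_derivative_iff_has_vector_derivative)
  have ys_cont: "continuous_on {0..} y" "continuous_on {0..} s"
    by (auto intro: has_derivative_imp_continuous_halfline ys)
  have clamp: "p a = a" "q b = b" if "(a, b) \<in> trap_box C" for a b
    using that by (auto simp: trap_box_def p_def q_def lo_def hi_def B_def)
  have in_box: "(y t, s t) \<in> trap_box C" if "0 \<le> t" for t
  proof (rule open_set_invariant[OF _ _ _ that, where f = "\<lambda>t. (y t, s t)"])
    show "continuous_on {0..} (\<lambda>t. (y t, s t))"
      by (intro continuous_intros ys_cont)
    show "open (trap_box C)"
      unfolding trap_box_def by (intro open_Times) auto
    fix b :: real
    assume b: "0 \<le> b" and before: "\<And>t. 0 \<le> t \<Longrightarrow> t < b \<Longrightarrow> (y t, s t) \<in> trap_box C"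
    show "(y b, s b) \<in> trap_box C"
    proof (cases "b = 0")
      case True
      then show ?thesis
        using start x(1) by (simp add: y_def s_def)
    next
      case False
      have lo_le: "lo \<le> y t" if "0 \<le> t" "t < b" for t
        using before[OF that] by (simp add: trap_box_def lo_def)
      have cont_b: "continuous_on {0..b} y" "continuous_on {0..b} s"
        by (auto intro: continuous_on_subset ys_cont)
      \<comment> \<open>The lower bound passes to \<open>b\<close> by continuity; it keeps
        \<open>y b\<close> positive, so that \<open>V\<close> makes sense there.\<close>
      have "lo \<le> y b"
      proof (rule continuous_ge_on_closure[where S = "{0..<b}" and f = y and x = b])
        show "continuous_on (closure {0..<b}) y"
          using cont_b False b by simp
      qed (use lo_le False b in auto)
      then have y_pos: "0 < y t" if "0 \<le> t" "t \<le> b" for t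
        using lo_le[of t] \<open>0 < lo\<close> that by (cases "t = b") auto
      \<comment> \<open>Before \<open>b\<close> the clamps are inactive, so the derivatives are
        those of the original equations.\<close>
      have "(y b, s b) \<in> trap_box (level (y 0) (s 0))"
      proof (rule trap_box_invariant[OF b cont_b])
        show "(y has_real_derivative y_rhs t (y t) (s t)) (at t)"
          "(s has_real_derivative s_rhs t (y t) (s t)) (at t)" if "0 < t" "t < b" for t
          using ys[of t] clamp[OF before[of t]] that by (simp_all add: at_within_halfline)
      qed (use y_pos in auto)
      then show ?thesis
        using x(1) by (simp add: y_def s_def C_def)
    qed
  qed
  have "trajectory y s"
    unfolding trajectory_def using ys clamp[OF in_box] by simp
  moreover have "y 0 = y0" "s 0 = s0"
    using x(1) by (simp_all add: y_def s_def)
  ultimately show ?thesis by blast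
qed

text \<open>Dissipation gives \<open>s \<longlongrightarrow> 0\<close>; the equation for \<open>s\<close> then reads \<open>s' = a * (y - \<xi>) + r\<close> with
  \<open>a\<close> bounded below and \<open>r \<longlongrightarrow> 0\<close>, which forces \<open>y \<longlongrightarrow> \<xi>\<close>.\<close>

theorem trajectory_converges:
  assumes traj: "trajectory y s" and y_pos: "\<And>t. 0 \<le> t \<Longrightarrow> 0 < y t"
  shows "(s \<longlongrightarrow> 0) at_top" and "((\<lambda>t. y t - \<xi>) \<longlongrightarrow> 0) at_top"
    and "((\<lambda>t. u t * y t - \<xi> * (u t - d t)) \<longlongrightarrow> 0) at_top"
proof -
  define C where "C = level (y 0) (s 0)"
  define lo where "lo = \<xi> / (2 * (\<beta> * C + 1))"
  define hi where "hi = \<xi> * exp (\<beta> * C + 1)"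
  define B where "B = C + 1"
  have C: "1 \<le> C"
    using level_ge[OF y_pos, of 0 "s 0"] V_nonneg[OF y_pos, of 0 "s 0"] by (simp add: C_def)
  then have "0 < lo" "0 < B"
    using pos by (auto simp: lo_def B_def intro!: divide_pos_pos add_pos_pos mult_pos_pos)
  have in_box: "(y t, s t) \<in> trap_box C" if "0 \<le> t" for t
    unfolding C_def
    by (rule trap_box_invariant[OF that])
      (auto intro: continuous_on_subset trajectory_continuous[OF traj] trajectory_deriv[OF traj] y_pos)
  have ylo: "lo \<le> y t" and yhi: "y t \<le> hi" and sB: "\<bar>s t\<bar> \<le> B" if "0 \<le> t" for t
    using in_box[OF that] by (auto simp: trap_box_def lo_def hi_def B_def)
  have "0 < hi"
    using \<open>0 < lo\<close> ylo[of 0] yhi[of 0] by simp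
  \<comment> \<open>The damping coefficient with \<open>y\<close> replaced by its lower bound on the
    box.\<close>
  define m where "m = \<kappa> * e0 * c * u0 * lo"
  have "\<exists>w. ((\<lambda>t. W t (y t) (s t)) has_real_derivative w) (at t) \<and> w \<le> - m * (s t)\<^sup>2" if "0 < t" for t
  proof -
    have le: "\<kappa> * e0 * c * u0 * lo * (s t)\<^sup>2 \<le> \<kappa> * e0 * c * u0 * y t * (s t)\<^sup>2"
      using ylo[of t] that pos by (intro mult_right_mono mult_left_mono) auto
    obtain w where "((\<lambda>t. W t (y t) (s t)) has_real_derivative w) (at t)"
      "w \<le> - (\<kappa> * e0 * c * u0 * y t) * (s t)\<^sup>2"
      by (rule W_deriv[OF \<open>0 < t\<close> trajectory_deriv[OF traj \<open>0 < t\<close>] y_pos]) (use \<open>0 < t\<close> in auto)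
    then show ?thesis
      using le by (auto simp: m_def intro!: exI[of _ w])
  qed
  then obtain w where w: "\<And>t. 0 < t \<Longrightarrow> ((\<lambda>t. W t (y t) (s t)) has_real_derivative w t) (at t)"
    "\<And>t. 0 < t \<Longrightarrow> w t \<le> - m * (s t)\<^sup>2"
    by metis
  define K where "K = c * (u1 * (hi * (1 + \<kappa> * B)) + \<xi> * (u1 + d0))"
  have s'_bound: "\<bar>s_rhs t (y t) (s t)\<bar> \<le> K" if "0 < t" for t
    unfolding K_def using that y_pos[of t] yhi[of t] sB[of t] by (intro s_rhs_bound) auto
  show s_lim: "(s \<longlongrightarrow> 0) at_top"
  proof (rule tendsto_zero_of_dissipation[OF w _ trajectory_deriv(2)[OF traj] s'_bound])
    show "0 \<le> W t (y t) (s t)" if "0 < t" for t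
      using V_nonneg[OF y_pos, of t "s t"] that by (simp add: W_def)
    show "0 < m"
      unfolding m_def using pos \<open>0 < lo\<close> by simp
    show "0 < K"
      unfolding K_def using pos u1_pos \<open>0 < hi\<close> \<open>0 < B\<close>
      by (intro mult_pos_pos add_pos_pos add_pos_nonneg) auto
  qed
  show y_lim: "((\<lambda>t. y t - \<xi>) \<longlongrightarrow> 0) at_top"
  proof (rule tendsto_zero_of_excitation[OF _ _ _ _ _ s_lim])
    show "((\<lambda>t. y t - \<xi>) has_real_derivative y_rhs t (y t) (s t)) (at t)" if "0 < t" for t
      using trajectory_deriv(1)[OF traj that] by (auto intro!: derivative_eq_intros)
    show "(s has_real_derivative
        (c * (e t * u t)) * (y t - \<xi>) + (c * \<xi> * (e t * d t) - c * \<kappa> * ((e t * u t * y t) * s t))) (at t)"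
      if "0 < t" for t
      using trajectory_deriv(2)[OF traj that] by (simp add: s_rhs_def algebra_simps)
    show "c * (e0 * u0) \<le> c * (e t * u t)" if "0 < t" for t
      using pos e(1)[of t] u(1)[of t] that by (intro mult_left_mono mult_mono) auto
    show "0 < c * (e0 * u0)"
      using pos by simp
    show "((\<lambda>t. y_rhs t (y t) (s t)) \<longlongrightarrow> 0) at_top"
    proof (rule Lim_null_comparison)
      show "\<forall>\<^sub>F t in at_top. norm (y_rhs t (y t) (s t)) \<le> \<beta> * c * u1 * hi\<^sup>2 * \<bar>s t\<bar>"
        using eventually_ge_at_top[of 0]
      proof eventually_elim
        case (elim t)
        then show ?case
          using y_rhs_bound[OF elim _ yhi[OF elim]] y_pos[OF elim] by simp
      qed
    qed (intro tendsto_mult_right_zero tendsto_rabs_zero s_lim)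
    have "((\<lambda>t. e t * d t) \<longlongrightarrow> 0) at_top"
    proof (rule Lim_null_comparison)
      show "\<forall>\<^sub>F t in at_top. norm (e t * d t) \<le> 1 * \<bar>d t\<bar>"
        using eventually_ge_at_top[of 0]
      proof eventually_elim
        case (elim t)
        then show ?case
          using e(2)[OF elim] e_pos[OF elim] by (simp add: abs_mult mult_left_le_one_le)
      qed
    qed (intro tendsto_mult_right_zero tendsto_rabs_zero d_tendsto_zero)
    moreover have "((\<lambda>t. (e t * u t * y t) * s t) \<longlongrightarrow> 0) at_top"
    proof (rule Lim_null_comparison)
      show "\<forall>\<^sub>F t in at_top. norm ((e t * u t * y t) * s t) \<le> (u1 * hi) * \<bar>s t\<bar>"
        using eventually_ge_at_top[of 0]
      proof eventually_elim
        case (elim t)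
        have "e t * u t * y t \<le> u1 * hi" "0 \<le> e t * u t * y t"
          using eu_bounds[OF elim] yhi[OF elim] y_pos[OF elim] u1_pos by (auto intro!: mult_mono)
        then show ?case
          by (simp add: abs_mult_nonneg_left mult_right_mono)
      qed
    qed (intro tendsto_mult_right_zero tendsto_rabs_zero s_lim)
    ultimately show "((\<lambda>t. c * \<xi> * (e t * d t) - c * \<kappa> * ((e t * u t * y t) * s t)) \<longlongrightarrow> 0) at_top"
      using tendsto_diff[OF tendsto_mult_right_zero tendsto_mult_right_zero] by fastforce
  qed
  \<comment> \<open>The remaining error equals \<open>u * (y - \<xi>) + \<xi> * d\<close>, and
    \<open>u\<close> is bounded.\<close>
  have "((\<lambda>t. u t * (y t - \<xi>)) \<longlongrightarrow> 0) at_top"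
  proof (rule Lim_null_comparison)
    show "\<forall>\<^sub>F t in at_top. norm (u t * (y t - \<xi>)) \<le> u1 * \<bar>y t - \<xi>\<bar>"
      using eventually_ge_at_top[of 0]
    proof eventually_elim
      case (elim t)
      then show ?case
        using u(2)[OF elim] u_pos[OF elim] by (simp add: abs_mult mult_right_mono)
    qed
  qed (intro tendsto_mult_right_zero tendsto_rabs_zero y_lim)
  then have "((\<lambda>t. u t * (y t - \<xi>) + \<xi> * d t) \<longlongrightarrow> 0) at_top"
    using tendsto_add[OF _ tendsto_mult_right_zero[OF d_tendsto_zero]] by fastforce
  then show "((\<lambda>t. u t * y t - \<xi> * (u t - d t)) \<longlongrightarrow> 0) at_top"
    by (simp add: algebra_simps)
qed

end

subsection \<open>The ratio of compositions\<close>

text \<open>Both \<open>X / X\<^sub>i\<^sub>n\<close> and its estimate solve this linear equation, in which the output error no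
  longer occurs.\<close>

definition ratio_equation where
  "ratio_equation k D e z \<longleftrightarrow>
     (\<forall>t\<ge>0. (z has_real_derivative D t - (D t + k * e t) * z t) (at t within {0..}))"
  for k :: real and D e z :: "real \<Rightarrow> real"

lemma ratio_continuous: "continuous_on {0..} z" if "ratio_equation k D e z"
  using that unfolding ratio_equation_def
  by (intro has_derivative_imp_continuous_halfline) auto

text \<open>A constant \<open>m \<le> \<alpha> / (M + k)\<close> is a subsolution, because
  \<open>D - (D + k * e) * m \<ge> \<alpha> - (M + k) * m \<ge> 0\<close>.\<close>

lemma ratio_lower:
  assumes z: "ratio_equation k D e z" and cont: "continuous_on {0..} D" "continuous_on {0..} e"
    and D: "\<And>t. 0 \<le> t \<Longrightarrow> \<alpha> \<le> D t" "\<And>t. 0 \<le> t \<Longrightarrow> D t \<le> M"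
    and e: "\<And>t. 0 \<le> t \<Longrightarrow> 0 \<le> e t" "\<And>t. 0 \<le> t \<Longrightarrow> e t \<le> 1"
    and pos: "0 < \<alpha>" "0 < k" "0 < z 0" and "0 \<le> t"
  shows "min (z 0) (\<alpha> / (M + k)) \<le> z t"
proof -
  define m where "m = min (z 0) (\<alpha> / (M + k))"
  have M: "0 < M"
    using D[of 0] pos by simp
  have m: "0 \<le> m" "m * (M + k) \<le> \<alpha>"
  proof -
    show "0 \<le> m"
      using pos M by (simp add: m_def)
    have "m * (M + k) \<le> \<alpha> / (M + k) * (M + k)"
      using pos M by (intro mult_right_mono) (auto simp: m_def)
    then show "m * (M + k) \<le> \<alpha>"
      using pos M by simp
  qed
  have "(z 0 - m) * exp (integral {0..t} (\<lambda>t. - (D t + k * e t))) \<le> z t - m"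
  proof (rule linear_comparison[where z = "\<lambda>t. z t - m" and z' = "\<lambda>t. D t - (D t + k * e t) * z t"])
    show "continuous_on {0..} (\<lambda>t. - (D t + k * e t))"
      by (intro continuous_intros cont)
    fix t :: real
    assume t: "0 \<le> t"
    show "((\<lambda>t. z t - m) has_real_derivative D t - (D t + k * e t) * z t) (at t within {0..})"
      using z t by (auto simp: ratio_equation_def intro!: derivative_eq_intros)
    have "k * e t \<le> k * 1"
      using e(2)[OF t] pos by (intro mult_left_mono) auto
    then have "m * (D t + k * e t) \<le> m * (M + k)"
      using D(2)[OF t] m by (intro mult_left_mono) auto
    then show "- (D t + k * e t) * (z t - m) \<le> D t - (D t + k * e t) * z t"
      using m D(1)[OF t] by (simp add: algebra_simps)
  qed fact
  moreover have "0 \<le> (z 0 - m) * exp (integral {0..t} (\<lambda>t. - (D t + k * e t)))"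
    by (simp add: m_def)
  ultimately have "m \<le> z t"
    by linarith
  then show ?thesis
    by (simp add: m_def)
qed

text \<open>Any constant \<open>m \<ge> 1\<close> is a supersolution, because
  \<open>D - (D + k * e) * m \<le> 0\<close>.\<close>

lemma ratio_upper:
  assumes z: "ratio_equation k D e z" and cont: "continuous_on {0..} D" "continuous_on {0..} e"
    and D: "\<And>t. 0 \<le> t \<Longrightarrow> 0 \<le> D t" and e: "\<And>t. 0 \<le> t \<Longrightarrow> 0 \<le> e t"
    and "0 < k" and "0 \<le> t"
  shows "z t \<le> max (z 0) 1"
proof -
  define m where "m = max (z 0) 1"
  have "(m - z 0) * exp (integral {0..t} (\<lambda>t. - (D t + k * e t))) \<le> m - z t"
  proof (rule linear_comparison[where z = "\<lambda>t. m - z t" and z' = "\<lambda>t. - (D t - (D t + k * e t) * z t)"])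
    show "continuous_on {0..} (\<lambda>t. - (D t + k * e t))"
      by (intro continuous_intros cont)
    fix t :: real
    assume t: "0 \<le> t"
    show "((\<lambda>t. m - z t) has_real_derivative - (D t - (D t + k * e t) * z t)) (at t within {0..})"
      using z t by (auto simp: ratio_equation_def intro!: derivative_eq_intros)
    have "D t * 1 \<le> D t * m"
      using D[OF t] by (intro mult_left_mono) (auto simp: m_def)
    moreover have "0 \<le> k * e t * m"
      using e[OF t] \<open>0 < k\<close> by (simp add: m_def)
    ultimately show "- (D t + k * e t) * (m - z t) \<le> - (D t - (D t + k * e t) * z t)"
      by (simp add: algebra_simps)
  qed fact
  moreover have "0 \<le> (m - z 0) * exp (integral {0..t} (\<lambda>t. - (D t + k * e t)))"
    by (simp add: m_def)
  ultimately have "z t \<le> m"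
    by linarith
  then show ?thesis
    by (simp add: m_def)
qed

lemma ratio_exists:
  assumes cont: "continuous_on {0..} D" "continuous_on {0..} e"
    and D: "\<And>t. 0 \<le> t \<Longrightarrow> 0 < D t" "\<And>t. 0 \<le> t \<Longrightarrow> D t \<le> M"
    and e: "\<And>t. 0 \<le> t \<Longrightarrow> 0 \<le> e t" "\<And>t. 0 \<le> t \<Longrightarrow> e t \<le> 1" and "0 < k"
  shows "\<exists>z. z 0 = z0 \<and> ratio_equation k D e z"
proof -
  have M: "0 < M"
    using D[of 0] by simp
  have coeff: "0 \<le> D t + k * e t" "D t + k * e t \<le> M + k" if "0 \<le> t" for t
  proof -
    have "0 \<le> k * e t" "k * e t \<le> k * 1"
      using e[OF that] \<open>0 < k\<close> by (auto intro!: mult_left_mono)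
    then show "0 \<le> D t + k * e t" "D t + k * e t \<le> M + k"
      using D[OF that] by auto
  qed
  have coeff_cont: "continuous_on ({0..} \<times> UNIV) (\<lambda>x :: real \<times> real. g (fst x))"
    if "continuous_on {0..} g" for g :: "real \<Rightarrow> real"
    by (rule continuous_on_compose2[OF that]) (auto intro!: continuous_intros)
  have "\<exists>z. z 0 = z0 \<and> (\<forall>t\<ge>0. (z has_vector_derivative D t - (D t + k * e t) * z t) (at t within {0..}))"
  proof (rule picard_lindelof_global[where f = "\<lambda>t x. D t - (D t + k * e t) * x"])
    show "continuous_on ({0..} \<times> UNIV) (\<lambda>(t, x). D t - (D t + k * e t) * x)"
      unfolding case_prod_beta by (intro continuous_intros coeff_cont cont)
    show "norm (D t - (D t + k * e t) * x - (D t - (D t + k * e t) * y)) \<le> (M + k) * norm (x - y)"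
      if "0 \<le> t" for t x y
    proof -
      have "D t - (D t + k * e t) * x - (D t - (D t + k * e t) * y) = (D t + k * e t) * (y - x)"
        by (simp add: algebra_simps)
      then show ?thesis
        using coeff[OF that] by (simp add: abs_mult mult_right_mono abs_minus_commute)
    qed
    show "norm (D t - (D t + k * e t) * z0) \<le> M + (M + k) * \<bar>z0\<bar>" if "0 \<le> t" for t
    proof -
      have "\<bar>(D t + k * e t) * z0\<bar> \<le> (M + k) * \<bar>z0\<bar>"
        using coeff[OF that] by (simp add: abs_mult mult_right_mono)
      then show ?thesis
        using D[OF that] by (simp add: abs_le_iff)
    qed
  qed (use M \<open>0 < k\<close> in auto)
  then show ?thesis
    by (simp add: ratio_equation_def has_real_derivative_iff_has_vector_derivative)
qed

lemma ratio_difference: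
  assumes z: "ratio_equation k D e z" "ratio_equation k D e w"
    and D: "\<And>t. 0 \<le> t \<Longrightarrow> \<alpha> \<le> D t" and e: "\<And>t. 0 \<le> t \<Longrightarrow> 0 \<le> e t" and "0 < k" "0 \<le> t"
  shows "\<bar>z t - w t\<bar> \<le> \<bar>z 0 - w 0\<bar> * exp (- \<alpha> * t)"
proof (rule linear_decay[where g = "\<lambda>t. D t + k * e t" and z = "\<lambda>t. z t - w t"])
  fix t :: real
  assume t: "0 \<le> t"
  show "((\<lambda>t. z t - w t) has_real_derivative - (D t + k * e t) * (z t - w t)) (at t within {0..})"
    using z t by (auto simp: ratio_equation_def algebra_simps intro!: derivative_eq_intros)
  show "\<alpha> \<le> D t + k * e t"
    using D[OF t] e[OF t] \<open>0 < k\<close> by (simp add: add_increasing2)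
qed fact

section \<open>Passage between the observer and the reduced observer\<close>

theorem theorem5:
  fixes E\<^sub>A R k c \<beta> \<kappa> M \<alpha> :: real
    and D T\<^sub>i\<^sub>n v X\<^sub>i\<^sub>n X T :: "real \<Rightarrow> real"
  assumes "E\<^sub>A > 0" and "R > 0" and "k > 0" and "c > 0"
    and "continuous_on {0..} D"
    and "reactor_trajectory E\<^sub>A R k c D T\<^sub>i\<^sub>n v X\<^sub>i\<^sub>n X T"
    and "\<alpha> > 0"
    and "\<And>t. t \<ge> 0 \<Longrightarrow> M \<ge> X\<^sub>i\<^sub>n t \<and> X\<^sub>i\<^sub>n t \<ge> \<alpha>"
    and "\<And>t. t \<ge> 0 \<Longrightarrow> M \<ge> D t \<and> D t \<ge> \<alpha>"
    and "\<And>t. t \<ge> 0 \<Longrightarrow> M \<ge> T t \<and> T t \<ge> \<alpha>"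
    and "\<beta> > 0" and "\<kappa> > 0"
  shows "globally_converging_observer E\<^sub>A R k c \<beta> \<kappa> D T\<^sub>i\<^sub>n v X\<^sub>i\<^sub>n X T"
proof -
  define e where "e = (\<lambda>t. arrhenius E\<^sub>A R (T t))"
  \<comment> \<open>The Arrhenius factor increases with temperature, so
    \<open>T \<ge> \<alpha>\<close> makes its value at \<open>\<alpha>\<close> a lower
    bound.\<close>
  define e0 where "e0 = arrhenius E\<^sub>A R \<alpha>"
  define \<xi> where "\<xi> = X\<^sub>i\<^sub>n 0"
  define w where "w = (\<lambda>t. X t / \<xi>)"
  note D_cont = assms(5)
  have D: "\<alpha> \<le> D t" "D t \<le> M" "0 < D t" "0 \<le> D t" if "0 \<le> t" for t
    using assms(9)[OF that] \<open>\<alpha> > 0\<close> by auto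
  have T: "\<alpha> \<le> T t" if "0 \<le> t" for t
    using assms(10)[OF that] by simp
  have Xin_deriv: "(X\<^sub>i\<^sub>n has_real_derivative 0) (at t within {0..})"
    and X_deriv: "(X has_real_derivative D t * (X\<^sub>i\<^sub>n t - X t) - k * e t * X t) (at t within {0..})"
    and T_deriv: "(T has_real_derivative D t * (T\<^sub>i\<^sub>n t - T t) + c * e t * X t + v t) (at t within {0..})"
    and X_pos: "0 < X t" and Xin_pos: "0 < X\<^sub>i\<^sub>n t" if "0 \<le> t" for t
    using assms(6) that by (auto simp: reactor_trajectory_def e_def)
  have T_cont: "continuous_on {0..} T"
    by (rule has_derivative_imp_continuous_halfline[OF T_deriv])
  have e_cont: "continuous_on {0..} e"
    unfolding e_def arrhenius_def using T \<open>R > 0\<close> \<open>\<alpha> > 0\<close>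
    by (intro continuous_intros T_cont) (auto dest!: T)
  have arr: "arrhenius E\<^sub>A R (T t) = e t" for t
    by (simp add: e_def)
  have e0: "0 < e0"
    by (simp add: e0_def arrhenius_def)
  have e: "e0 \<le> e t" "e t \<le> 1" "0 \<le> e t" if "0 \<le> t" for t
    using T[OF that] \<open>E\<^sub>A > 0\<close> \<open>R > 0\<close> \<open>\<alpha> > 0\<close>
    by (auto simp: e_def e0_def arrhenius_def intro!: divide_left_mono mult_left_mono mult_pos_pos)
  have \<xi>: "0 < \<xi>"
    by (simp add: \<xi>_def Xin_pos)
  have Xin: "X\<^sub>i\<^sub>n t = \<xi>" if "0 \<le> t" for t
  proof -
    obtain C where "\<And>t. t \<in> {0..} \<Longrightarrow> X\<^sub>i\<^sub>n t = C"
      using has_field_derivative_zero_constant[of "{0..}" X\<^sub>i\<^sub>n] Xin_deriv by auto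
    then show ?thesis
      using that by (simp add: \<xi>_def)
  qed
  have X: "X t = \<xi> * w t" for t
    using \<xi> by (simp add: w_def)
  have w: "ratio_equation k D e w"
    unfolding ratio_equation_def w_def using \<xi> Xin
    by (auto intro!: derivative_eq_intros X_deriv simp: field_simps)
  \<comment> \<open>Stated for any solution \<open>u\<close> with positive start, as it serves both
    the trajectory to be constructed and an arbitrary given one.\<close>
  have reduced: "reduced_observer \<alpha> e0 (min (u 0) (\<alpha> / (M + k))) (max (u 0) 1) \<bar>u 0 - w 0\<bar> c \<beta> \<kappa> \<xi> e u
      (\<lambda>t. u t - w t)" if u: "ratio_equation k D e u" "0 < u 0" for u
  proof
    have "0 < M"
      using D[of 0] \<open>\<alpha> > 0\<close> by simp
    then show "0 < min (u 0) (\<alpha> / (M + k))"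
      using u \<open>\<alpha> > 0\<close> \<open>k > 0\<close> by simp
    show "continuous_on {0..} u" "continuous_on {0..} (\<lambda>t. u t - w t)"
      by (intro continuous_on_diff ratio_continuous[OF u(1)] ratio_continuous[OF w])+
    fix t :: real
    assume t: "0 \<le> t"
    show "min (u 0) (\<alpha> / (M + k)) \<le> u t"
      by (rule ratio_lower[OF u(1) D_cont e_cont D(1,2) e(3,2) _ _ u(2) t]) (use assms in auto)
    show "u t \<le> max (u 0) 1"
      by (rule ratio_upper[OF u(1) D_cont e_cont D(4) e(3) _ t]) (use assms in auto)
    show "\<bar>u t - w t\<bar> \<le> \<bar>u 0 - w 0\<bar> * exp (- \<alpha> * t)"
      by (rule ratio_difference[OF u(1) w D(1) e(3) _ t]) (use assms in auto)
  qed (use assms e e0 \<xi> e_cont in auto)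
  show ?thesis
    unfolding globally_converging_observer_def
  proof (intro allI impI conjI)
    fix a b s0 :: real
    assume ab: "0 < a" "0 < b"
    \<comment> \<open>The ratio equation is decoupled, so \<open>u\<close> is found first; the
      reduced system driven by it yields \<open>y\<close> and \<open>\<sigma>\<close>, and the
      observer states are \<open>y\<close>, \<open>u * y\<close> and
      \<open>\<sigma> + T\<close>.\<close>
    obtain u where ratio: "u 0 = b / a" "ratio_equation k D e u"
      using ratio_exists[OF D_cont e_cont D(3,2) e(3,2) \<open>k > 0\<close>] by blast
    interpret reduced_observer \<alpha> e0 "min (u 0) (\<alpha> / (M + k))" "max (u 0) 1" "\<bar>u 0 - w 0\<bar>" c \<beta> \<kappa> \<xi> e u
      "\<lambda>t. u t - w t"
      using reduced[OF ratio(2)] ratio(1) ab by simp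
    obtain y \<sigma> where tr: "trajectory y \<sigma>" "y 0 = a" "\<sigma> 0 = s0 - T 0"
      using trajectory_exists[OF ab(1)] by blast
    have y: "(y has_real_derivative y_rhs t (y t) (\<sigma> t)) (at t within {0..})"
      and \<sigma>: "(\<sigma> has_real_derivative s_rhs t (y t) (\<sigma> t)) (at t within {0..})"
      and u': "(u has_real_derivative D t - (D t + k * e t) * u t) (at t within {0..})" if "0 \<le> t" for t
      using tr(1) ratio(2) that by (auto simp: trajectory_def ratio_equation_def)
    have "observer_trajectory E\<^sub>A R k c \<beta> \<kappa> D T\<^sub>i\<^sub>n v T y (\<lambda>t. u t * y t) (\<lambda>t. \<sigma> t + T t)"
      unfolding observer_trajectory_def
    proof (intro allI impI conjI)
      fix t :: real
      assume t: "0 \<le> t"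
      show "(y has_real_derivative - \<beta> * arrhenius E\<^sub>A R (T t) * (\<sigma> t + T t - T t) * c * (u t * y t) * y t)
          (at t within {0..})"
        using y[OF t] by (rule DERIV_cong) (simp add: y_rhs_def arr power2_eq_square)
      show "((\<lambda>t. u t * y t) has_real_derivative D t * (y t - u t * y t) - arrhenius E\<^sub>A R (T t)
          * (k + \<beta> * (\<sigma> t + T t - T t) * c * (u t * y t)) * (u t * y t)) (at t within {0..})"
        by (rule DERIV_cong[OF DERIV_mult[OF u'[OF t] y[OF t]]])
          (simp add: y_rhs_def arr power2_eq_square algebra_simps)
      show "((\<lambda>t. \<sigma> t + T t) has_real_derivative arrhenius E\<^sub>A R (T t) * (1 - \<kappa> * (\<sigma> t + T t - T t)) * c
          * (u t * y t) + D t * (T\<^sub>i\<^sub>n t - T t) + v t) (at t within {0..})"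
        by (rule DERIV_cong[OF DERIV_add[OF \<sigma>[OF t] T_deriv[OF t]]])
          (simp add: s_rhs_def arr X algebra_simps)
    qed
    moreover have "u 0 * y 0 = b" "\<sigma> 0 + T 0 = s0"
      using ratio(1) tr ab by auto
    ultimately show "\<exists>Y\<^sub>i\<^sub>n Y S. observer_trajectory E\<^sub>A R k c \<beta> \<kappa> D T\<^sub>i\<^sub>n v T Y\<^sub>i\<^sub>n Y S \<and>
        Y\<^sub>i\<^sub>n 0 = a \<and> Y 0 = b \<and> S 0 = s0"
      using tr(2) by (intro exI[of _ y] exI[of _ "\<lambda>t. u t * y t"] exI[of _ "\<lambda>t. \<sigma> t + T t"]) auto
  next
    fix a b s0 :: real and Y\<^sub>i\<^sub>n Y S
    assume ab: "0 < a" "0 < b" and obs: "observer_trajectory E\<^sub>A R k c \<beta> \<kappa> D T\<^sub>i\<^sub>n v T Y\<^sub>i\<^sub>n Y S"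
      and init: "Y\<^sub>i\<^sub>n 0 = a" "Y 0 = b" "S 0 = s0"
    define \<sigma> where "\<sigma> = (\<lambda>t. S t - T t)"
    define u where "u = (\<lambda>t. Y t / Y\<^sub>i\<^sub>n t)"
    have Yin': "(Y\<^sub>i\<^sub>n has_real_derivative - \<beta> * e t * \<sigma> t * c * Y t * Y\<^sub>i\<^sub>n t) (at t within {0..})"
      and Y': "(Y has_real_derivative D t * (Y\<^sub>i\<^sub>n t - Y t) - e t * (k + \<beta> * \<sigma> t * c * Y t) * Y t)
        (at t within {0..})"
      and S': "(S has_real_derivative e t * (1 - \<kappa> * \<sigma> t) * c * Y t + D t * (T\<^sub>i\<^sub>n t - T t) + v t)
        (at t within {0..})" if "0 \<le> t" for t
      using obs that by (auto simp: observer_trajectory_def \<sigma>_def e_def)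
    have Y_cont: "continuous_on {0..} Y" "continuous_on {0..} S"
      by (auto intro: has_derivative_imp_continuous_halfline Y' S')
    \<comment> \<open>Along the trajectory \<open>Y\<^sub>i\<^sub>n\<close> solves a homogeneous
      linear equation with continuous coefficient, hence keeps its sign. This justifies dividing by
      it in \<open>u\<close>.\<close>
    have Yin_pos: "0 < Y\<^sub>i\<^sub>n t" if "0 \<le> t" for t
    proof -
      have "Y\<^sub>i\<^sub>n 0 * exp (integral {0..t} (\<lambda>t. - \<beta> * e t * \<sigma> t * c * Y t)) \<le> Y\<^sub>i\<^sub>n t"
      proof (rule linear_comparison[OF _ Yin'])
        show "continuous_on {0..} (\<lambda>t. - \<beta> * e t * \<sigma> t * c * Y t)"
          unfolding \<sigma>_def by (intro continuous_intros e_cont Y_cont T_cont)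
      qed (use that in auto)
      then show ?thesis
        using ab(1) init(1) by (smt (verit) exp_gt_zero mult_pos_pos)
    qed
    have Y: "Y t = u t * Y\<^sub>i\<^sub>n t" if "0 \<le> t" for t
      using Yin_pos[OF that] by (simp add: u_def)
    \<comment> \<open>The \<open>\<beta>\<close> corrections contribute the same logarithmic
      derivative to \<open>Y\<close> and \<open>Y\<^sub>i\<^sub>n\<close> and cancel in the
      quotient.\<close>
    have ratio: "ratio_equation k D e u"
      unfolding ratio_equation_def
    proof (intro allI impI)
      fix t :: real
      assume t: "0 \<le> t"
      show "(u has_real_derivative D t - (D t + k * e t) * u t) (at t within {0..})"
        unfolding u_def using Yin_pos[OF t]
        by (intro DERIV_cong[OF DERIV_divide[OF Y'[OF t] Yin'[OF t]]]) (auto simp: field_simps)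
    qed
    have u0: "0 < u 0"
      using ab init by (simp add: u_def)
    interpret reduced_observer \<alpha> e0 "min (u 0) (\<alpha> / (M + k))" "max (u 0) 1" "\<bar>u 0 - w 0\<bar>" c \<beta> \<kappa> \<xi> e u
      "\<lambda>t. u t - w t"
      by (rule reduced[OF ratio u0])
    have traj: "trajectory Y\<^sub>i\<^sub>n \<sigma>"
      unfolding trajectory_def
    proof (intro allI impI conjI)
      fix t :: real
      assume t: "0 \<le> t"
      show "(Y\<^sub>i\<^sub>n has_real_derivative y_rhs t (Y\<^sub>i\<^sub>n t) (\<sigma> t)) (at t within {0..})"
        by (rule DERIV_cong[OF Yin'[OF t]]) (simp add: y_rhs_def Y[OF t] power2_eq_square)
      show "(\<sigma> has_real_derivative s_rhs t (Y\<^sub>i\<^sub>n t) (\<sigma> t)) (at t within {0..})"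
        unfolding \<sigma>_def by (rule DERIV_cong[OF DERIV_diff[OF S'[OF t] T_deriv[OF t]]])
          (simp add: s_rhs_def \<sigma>_def Y[OF t] X algebra_simps)
    qed
    note lim = trajectory_converges[OF traj Yin_pos]
    have late: "\<forall>\<^sub>F t in at_top. (0 :: real) \<le> t"
      by (rule eventually_ge_at_top)
    show "0 < Y\<^sub>i\<^sub>n t" "0 < Y t" if "0 \<le> t" for t
      using Yin_pos[OF that] u_pos[OF that] Y[OF that] by auto
    show "((\<lambda>t. Y\<^sub>i\<^sub>n t - X\<^sub>i\<^sub>n t) \<longlongrightarrow> 0) at_top"
      using lim(2)
    proof (rule Lim_transform_eventually)
      show "\<forall>\<^sub>F t in at_top. Y\<^sub>i\<^sub>n t - \<xi> = Y\<^sub>i\<^sub>n t - X\<^sub>i\<^sub>n t"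
        using late by eventually_elim (simp add: Xin)
    qed
    \<comment> \<open>With \<open>d = u - w\<close> the term \<open>\<xi> * (u - d)\<close> is
      \<open>\<xi> * w\<close>, which is \<open>X\<close>.\<close>
    show "((\<lambda>t. Y t - X t) \<longlongrightarrow> 0) at_top"
      using lim(3)
    proof (rule Lim_transform_eventually)
      show "\<forall>\<^sub>F t in at_top. u t * Y\<^sub>i\<^sub>n t - \<xi> * (u t - (u t - w t)) = Y t - X t"
        using late by eventually_elim (simp add: Y X)
    qed
    show "((\<lambda>t. S t - T t) \<longlongrightarrow> 0) at_top"
      using lim(1) by (simp add: \<sigma>_def)
  qed
qed

end
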